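(* Let $n\in\mathbb{N}$, $R_0>0$ and $\mathcal{B}=B_{R_0}(0)\subset\mathbb{R}^2$. Suppose that the configuration $\big((a_i)_{i=1}^n,(v_i)_{i=1}^n\big)$ is attainable, with $\lambda>1$ given by $\sum_i v_i=(\lambda^2-1)\pi R_0^2$ and with evolutions $z_i$, $L_i$ on $[1,\lambda]$ of centers and radii as in the definition of attainability. Let $R_1,\dots,R_n$ be any positive numbers such that, with $r_i(t):=\sqrt{L_i(t)^2+R_i^2}$, at all times $t\in[1,\lambda]$ the disks $\overline{B}_{r_i(t)}(z_i(t))$, $i=1,\dots,n$, are disjoint and contained in $B_{tR_0}(0)$. Then there exists $u_{\mathrm{far}}\in H^1\big(\mathcal{B}\setminus\bigcup_{i=1}^n\overline{B}_{R_i}(a_i),\mathbb{R}^2\big)$ satisfying $u_{\mathrm{far}}(x)=\lambda x$ on $\partial\mathcal{B}$; $\det Du_{\mathrm{far}}\equiv1$ in $\mathcal{B}\setminus\bigcup_{i=1}^n\overline{B}_{R_i}(a_i)$; condition INV; and $$u_{\mathrm{far}}(a_i+R_ie^{i\theta})=z_i(\lambda)+\sqrt{L_i(\lambda)^2+R_i^2}\,e^{i\theta}\qquad\forall\,i\in\{1,\dots,n\},\ \forall\,\theta\in[0,2\pi].$$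
   Context: $B_r(x)$ is the open disk of radius $r$ centred at $x\in\mathbb{R}^2$. $\mathbb{R}^2$ is identified with $\mathbb{C}$ in writing $e^{i\theta}=(\cos\theta,\sin\theta)$ (the $i$ in the exponent is the imaginary unit, not the index). Attainable configuration. Let $n\in\mathbb{N}$, $R_0>0$, $\mathcal{B}=B_{R_0}(0)\subset\mathbb{R}^2$. The pair $\big((a_i)_{i=1}^n,(v_i)_{i=1}^n\big)$ is an attainable configuration (through an evolution of circular cavities) if $a_i\in\mathcal{B}$ and $v_i>0$ for all $i$ and, with $\lambda>1$ given by $\sum_i v_i=(\lambda^2-1)\pi R_0^2$, there exist $z_i\in C^1([1,\lambda],\mathbb{R}^2)$ and $L_i:[1,\lambda]\to[0,\infty)$, $i=1,\dots,n$, such that $\sum_{i=1}^n\pi L_i^2(t)=(t^2-1)\pi R_0^2$ for all $t\in[1,\lambda]$ and, for each $i$: (i) $L_i^2\in C^1([1,\lambda],[0,\infty))$; (ii) $z_i(1)=a_i$ and $L_i(1)=0$; (iii) $\pi L_i^2(\lambda)=v_i$; (iv) for all $t\in[1,\lambda]$ the disks $\overline{B}_{L_i(t)}(z_i(t))$, $i=1,\dots,n$, are disjoint and contained in $B_{tR_0}(0)$. Topological image. For $u\in W^{1,p}(\partial B_r(x),\mathbb{R}^2)$ with $p>1$ (identified with its continuous representative), $\mathrm{im}_T(u,B_r(x)):=\{y\in\mathbb{R}^2:\deg(u,\partial B_r(x),y)\ne0\}$, where $\deg$ is the Brouwer degree (winding number), defined for $y\notin u(\partial B_r(x))$. Condition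 INV. Let $E=\mathcal{B}\setminus\bigcup_{i=1}^n\overline{B}_{R_i}(a_i)$ and $u\in W^{1,p}(E,\mathbb{R}^2)$, $p>1$. For each $x\in\mathcal{B}$ there is a set $R_x\subset(0,\infty)$, coinciding up to a null set with $\{r>0:B_r(x)\subset\mathcal{B},\ \partial B_r(x)\subset E\}$, such that for all $r\in R_x$ one has $u|_{\partial B_r(x)}\in W^{1,p}$ and $\deg(u,\partial B_r(x),\cdot)$ and $\mathrm{im}_T(u,B_r(x))$ are well defined. $u$ satisfies condition INV in $E$ if for every such $x$ and every $r\in R_x$: (i) $u(z)\in\mathrm{im}_T(u,B_r(x))$ for a.e. $z\in B_r(x)\cap E$, and (ii) $u(z)\in\mathbb{R}^2\setminus\mathrm{im}_T(u,B_r(x))$ for a.e. $z\in E\setminus B_r(x)$. *)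

theory Defs
  imports "HOL-Complex_Analysis.Complex_Analysis"
begin

section \<open>Sobolev spaces\<close>

primrec Ck :: "nat \<Rightarrow> (real^'n \<Rightarrow> real) \<Rightarrow> bool" where
  "Ck 0 f \<longleftrightarrow> continuous_on UNIV f"
| "Ck (Suc k) f \<longleftrightarrow>
     (\<forall>x. f differentiable at x) \<and>
     (\<forall>j. Ck k (\<lambda>x. frechet_derivative f (at x) (axis j 1)))"

definition test_function :: "(real^'n) set \<Rightarrow> (real^'n \<Rightarrow> real) \<Rightarrow> bool" where
  "test_function U \<phi> \<longleftrightarrow>
     (\<forall>k. Ck k \<phi>) \<and> compact (closure {x. \<phi> x \<noteq> 0}) \<and> closure {x. \<phi> x \<noteq> 0} \<subseteq> U"

definition Lp_on :: "real \<Rightarrow> 'a::euclidean_space set \<Rightarrow> ('a \<Rightarrow> 'b::euclidean_space) \<Rightarrow> bool" where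
  "Lp_on p S f \<longleftrightarrow>
     f \<in> borel_measurable (lebesgue_on S) \<and>
     integrable (lebesgue_on S) (\<lambda>x. norm (f x) powr p)"

text \<open>\<open>W1p p U u Du\<close>: \<open>u\<close> belongs to \<open>W\<^sup>1\<^sup>,\<^sup>p(U)\<close>, with weak gradient \<open>Du\<close>
  (so \<open>Du x $ i $ j\<close> is the \<open>j\<close>-th weak partial derivative of the component \<open>u\<^sub>i\<close>).
  For \<open>p = 2\<close> this is \<open>H\<^sup>1(U)\<close>. The set \<open>U\<close> is meant to be open.\<close>

definition W1p ::
  "real \<Rightarrow> (real^'n) set \<Rightarrow> (real^'n \<Rightarrow> real^'m) \<Rightarrow> (real^'n \<Rightarrow> real^'n^'m) \<Rightarrow> bool" where
  "W1p p U u Du \<longleftrightarrow>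
     Lp_on p U u \<and> Lp_on p U Du \<and>
     (\<forall>\<phi>. test_function U \<phi> \<longrightarrow>
       (\<forall>i j. integral\<^sup>L (lebesgue_on U) (\<lambda>x. u x $ i * frechet_derivative \<phi> (at x) (axis j 1))
            = - integral\<^sup>L (lebesgue_on U) (\<lambda>x. Du x $ i $ j * \<phi> x)))"


section \<open>Circles\<close>

text \<open>The point \<open>e\<^sup>i\<^sup>\<theta>\<close> of the plane.\<close>

definition expi2 :: "real \<Rightarrow> real^2" where
  "expi2 \<theta> = vector [cos \<theta>, sin \<theta>]"

definition complex_of_plane :: "real^2 \<Rightarrow> complex" where
  "complex_of_plane y = Complex (y $ 1) (y $ 2)"

text \<open>The Sobolev trace on one boundary circle. For a bounded Lipschitz domain \<open>U\<close> the trace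
  operator is the unique bounded operator from \<open>W\<^sup>1\<^sup>,\<^sup>p(U)\<close> to \<open>L\<^sup>p\<close> of the boundary that is
  the restriction on \<open>W\<^sup>1\<^sup>,\<^sup>p(U) \<inter> C(closure U)\<close>; its graph is the closure of the graph of the
  restriction. The predicate says that the trace of \<open>u\<close> on the circle \<open>sphere c \<rho>\<close>, a connected
  component of the boundary of \<open>U\<close>, is (almost everywhere) \<open>g\<close>.\<close>

definition circle_trace ::
  "real \<Rightarrow> (real^2) set \<Rightarrow> (real^2 \<Rightarrow> real^2) \<Rightarrow> (real^2 \<Rightarrow> real^2^2) \<Rightarrow>
   real^2 \<Rightarrow> real \<Rightarrow> (real^2 \<Rightarrow> real^2) \<Rightarrow> bool" where
  "circle_trace p U u Du c \<rho> g \<longleftrightarrow>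
     Lp_on p {0..2*pi} (\<lambda>\<theta>. g (c + \<rho> *\<^sub>R expi2 \<theta>)) \<and>
     (\<exists>\<psi> D\<psi>.
        (\<forall>k::nat. W1p p U (\<psi> k) (D\<psi> k) \<and> continuous_on (closure U) (\<psi> k)) \<and>
        (\<lambda>k. integral\<^sup>L (lebesgue_on U) (\<lambda>x. norm (\<psi> k x - u x) powr p)) \<longlonglongrightarrow> 0 \<and>
        (\<lambda>k. integral\<^sup>L (lebesgue_on U) (\<lambda>x. norm (D\<psi> k x - Du x) powr p)) \<longlonglongrightarrow> 0 \<and>
        (\<lambda>k. integral\<^sup>L (lebesgue_on {0..2*pi})
                (\<lambda>\<theta>. norm (\<psi> k (c + \<rho> *\<^sub>R expi2 \<theta>) - g (c + \<rho> *\<^sub>R expi2 \<theta>)) powr p))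
          \<longlonglongrightarrow> 0)"

text \<open>\<open>g\<close> is the continuous representative of the restriction of \<open>u\<close> to the circle, and this
  restriction is in \<open>W\<^sup>1\<^sup>,\<^sup>p\<close> of the circle, i.e. \<open>g\<close> is absolutely continuous in the angle,
  with derivative \<open>h\<close> in \<open>L\<^sup>p\<close>. On the circle, \<open>g\<close> is determined by \<open>u\<close>.\<close>

definition W1p_circle_rep ::
  "real \<Rightarrow> (real^2 \<Rightarrow> real^2) \<Rightarrow> real^2 \<Rightarrow> real \<Rightarrow> (real^2 \<Rightarrow> real^2) \<Rightarrow> bool" where
  "W1p_circle_rep p u x r g \<longleftrightarrow>
     continuous_on (sphere x r) g \<and>
     (AE \<theta> in lebesgue_on {0..2*pi}. u (x + r *\<^sub>R expi2 \<theta>) = g (x + r *\<^sub>R expi2 \<theta>)) \<and>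
     (\<exists>h. Lp_on p {0..2*pi} h \<and>
        (\<forall>\<theta>\<in>{0..2*pi}.
           (h has_integral (g (x + r *\<^sub>R expi2 \<theta>) - g (x + r *\<^sub>R expi2 0))) {0..\<theta>}))"


section \<open>Degree, topological image and condition INV\<close>

text \<open>The degree of a map continuous on the circle is the winding number of the image of the
  circle, traversed once counterclockwise. It is only meaningful for \<open>y \<notin> g ` sphere x r\<close>.\<close>

definition circle_degree :: "(real^2 \<Rightarrow> real^2) \<Rightarrow> real^2 \<Rightarrow> real \<Rightarrow> real^2 \<Rightarrow> complex" where
  "circle_degree g x r y =
     winding_number (\<lambda>s. complex_of_plane (g (x + r *\<^sub>R expi2 (2 * pi * s)))) (complex_of_plane y)"

definition im_T :: "(real^2 \<Rightarrow> real^2) \<Rightarrow> real^2 \<Rightarrow> real \<Rightarrow> (real^2) set" where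
  "im_T g x r = {y. y \<notin> g ` sphere x r \<and> circle_degree g x r y \<noteq> 0}"

definition radii :: "(real^2) set \<Rightarrow> (real^2) set \<Rightarrow> real^2 \<Rightarrow> real set" where
  "radii B E x = {r. r > 0 \<and> ball x r \<subseteq> B \<and> sphere x r \<subseteq> E}"

text \<open>\<open>Rx\<close> is a set of good radii of full measure in \<open>radii B E x\<close>; the quantification over it
  makes the condition independent of the values of \<open>u\<close> on null sets.\<close>

definition INV ::
  "real \<Rightarrow> (real^2) set \<Rightarrow> (real^2) set \<Rightarrow> (real^2 \<Rightarrow> real^2) \<Rightarrow> bool" where
  "INV p B E u \<longleftrightarrow>
     (\<forall>x\<in>B. \<exists>Rx. Rx \<subseteq> radii B E x \<and> negligible (radii B E x - Rx) \<and>
        (\<forall>r\<in>Rx. \<exists>g. W1p_circle_rep p u x r g \<and>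
           (AE y in lebesgue_on (ball x r \<inter> E). u y \<in> im_T g x r) \<and>
           (AE y in lebesgue_on (E - ball x r). u y \<notin> im_T g x r)))"


section \<open>Attainable configurations\<close>

definition C1_on_interval :: "real \<Rightarrow> real \<Rightarrow> (real \<Rightarrow> 'a::real_normed_vector) \<Rightarrow> bool" where
  "C1_on_interval s t f \<longleftrightarrow>
     (\<exists>f'. (\<forall>x\<in>{s..t}. (f has_vector_derivative f' x) (at x within {s..t})) \<and>
           continuous_on {s..t} f')"

text \<open>The configuration \<open>((a i), (v i))\<close>, \<open>1 \<le> i \<le> n\<close>, is attainable, as witnessed by the
  evolutions of centres \<open>z\<close> and radii \<open>L\<close> on \<open>{1..lam}\<close>; it is attainable if such
  \<open>lam\<close>, \<open>z\<close>, \<open>L\<close> exist.\<close>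

definition attainable_via ::
  "nat \<Rightarrow> real \<Rightarrow> (nat \<Rightarrow> real^2) \<Rightarrow> (nat \<Rightarrow> real) \<Rightarrow>
   real \<Rightarrow> (nat \<Rightarrow> real \<Rightarrow> real^2) \<Rightarrow> (nat \<Rightarrow> real \<Rightarrow> real) \<Rightarrow> bool" where
  "attainable_via n R0 a v lam z L \<longleftrightarrow>
     (\<forall>i\<in>{1..n}. a i \<in> ball 0 R0 \<and> v i > 0) \<and>
     lam > 1 \<and> (\<Sum>i=1..n. v i) = (lam\<^sup>2 - 1) * pi * R0\<^sup>2 \<and>
     (\<forall>t\<in>{1..lam}. (\<Sum>i=1..n. pi * (L i t)\<^sup>2) = (t\<^sup>2 - 1) * pi * R0\<^sup>2) \<and>
     (\<forall>i\<in>{1..n}.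
        C1_on_interval 1 lam (z i) \<and>
        (\<forall>t\<in>{1..lam}. L i t \<ge> 0) \<and>
        C1_on_interval 1 lam (\<lambda>t. (L i t)\<^sup>2) \<and>
        z i 1 = a i \<and> L i 1 = 0 \<and>
        pi * (L i lam)\<^sup>2 = v i) \<and>
     (\<forall>t\<in>{1..lam}.
        disjoint_family_on (\<lambda>i. cball (z i t) (L i t)) {1..n} \<and>
        (\<forall>i\<in>{1..n}. cball (z i t) (L i t) \<subseteq> ball 0 (t * R0)))"

definition perforated_disk :: "nat \<Rightarrow> real \<Rightarrow> (nat \<Rightarrow> real^2) \<Rightarrow> (nat \<Rightarrow> real) \<Rightarrow> (real^2) set" where
  "perforated_disk n R0 a R = ball 0 R0 - (\<Union>i\<in>{1..n}. cball (a i) (R i))"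

end

theory Submission
  imports Defs
begin

text \<open>
  The map is the time \<open>lam\<close> flow of an area-preserving motion that drags the holes along. At time
  \<open>t\<close> the moving domain is the disk of radius \<open>t R0\<close> minus the closed disks of centre \<open>z\<^sub>i(t)\<close> and
  radius \<open>r\<^sub>i(t) = sqrt (L\<^sub>i(t)\<^sup>2 + R\<^sub>i\<^sup>2)\<close>. Suppose a velocity field, \<open>C\<^sup>1\<close> in space and continuous
  in time, is divergence free in the moving domain, equals \<open>t R0\<^sup>2 w / \<bar>w\<bar>\<^sup>2\<close> on the outer circle and
  \<open>z\<^sub>i' + c\<^sub>i (w - z\<^sub>i) / r\<^sub>i\<^sup>2\<close> on the \<open>i\<close>-th hole, with \<open>c\<^sub>i = r\<^sub>i r\<^sub>i' = (L\<^sub>i\<^sup>2)' / 2\<close>. Then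
  \<open>t R0 \<zeta>\<close> and \<open>z\<^sub>i(t) + r\<^sub>i(t) \<zeta>\<close> are trajectories for every unit vector \<open>\<zeta>\<close>, which gives the
  boundary values. Trajectories never meet, so none that starts between the circles leaves the
  moving domain, and by Liouville's theorem the flow has Jacobian determinant one there. The flow
  is a \<open>C\<^sup>1\<close> injection of the whole plane, so membership in \<open>H\<^sup>1\<close> and the traces are classical.
  Condition INV is the homotopy invariance of the winding number: as \<open>t\<close> varies, the image of a
  point off a circle never hits the image of the circle, so the degree is what it is for the
  identity.

  The velocity is explicit. The incompressibility constraint \<open>\<Sum> \<pi> L\<^sub>i\<^sup>2 = (t\<^sup>2 - 1) \<pi> R0\<^sup>2\<close> says that
  \<open>\<Sum> c\<^sub>i = t R0\<^sup>2\<close>, i.e. the fluxes through the holes balance the flux through the outer circle. The sum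
  of the point sources \<open>c\<^sub>j (w - z\<^sub>j) / \<bar>w - z\<^sub>j\<bar>\<^sup>2\<close> therefore has the right flux on each circle, and near each
  circle it differs from the desired field by the conjugate derivative of a holomorphic function
  \<open>F\<close>: for a hole \<open>F\<close> consists of a linear term and of logarithms \<open>Ln ((w - z\<^sub>j) / (z\<^sub>i - z\<^sub>j))\<close>, \<open>j \<noteq> i\<close>,
  for the outer circle of logarithms \<open>Ln ((w - z\<^sub>j) / w)\<close>, all of them single valued where they
  are needed. Multiplying the stream function \<open>Im F\<close> by a cutoff supported near that circle keeps
  the correction divergence free and confines it (\<open>stream_block\<close>).

  The main steps are the flow of a \<open>C\<^sup>1\<close> field and its spatial derivative (locale \<open>c1_field\<close>), the
  velocity (locale \<open>moving_disks\<close>), the resulting isotopy (\<open>exists_isotopy\<close>), and the two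
  translations \<open>W1p_of_C1\<close> and \<open>INV_of_isotopy\<close> from classical properties of a map.
\<close>

section \<open>Flows of continuously differentiable fields\<close>

lemma antitone_of_nonpos_derivative:
  fixes f :: "real \<Rightarrow> real"
  assumes "s \<le> t"
    and "\<And>r. r \<in> {s..t} \<Longrightarrow> (f has_real_derivative f' r) (at r within {s..t})"
    and "\<And>r. r \<in> {s..t} \<Longrightarrow> f' r \<le> 0"
  shows "f t \<le> f s"
proof -
  obtain r where "r \<in> {s..t}" "f t - f s = f' r * (t - s)"
    using mvt_very_simple[of s t f "\<lambda>r. (*) (f' r)"] assms(1,2)
    by (auto simp: has_field_derivative_def)
  with assms(1,3) show ?thesis
    by (metis diff_ge_0_iff_ge diff_le_0_iff_le mult_nonneg_nonpos2 mult.commute)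
qed

text \<open>The inhomogeneity \<open>\<epsilon>\<close> is absorbed by working with \<open>\<bar>e\<bar>\<^sup>2 + \<epsilon>\<^sup>2\<close>: since \<open>2 \<epsilon> \<bar>e\<bar> \<le> \<bar>e\<bar>\<^sup>2 + \<epsilon>\<^sup>2\<close>, its
  derivative is at most \<open>2 K + 1\<close> times itself.
  The square is used because it is differentiable where \<open>e\<close> vanishes.\<close>

lemma gronwall_forward:
  fixes e :: "real \<Rightarrow> 'a::real_inner"
  assumes "s \<le> t" "K \<ge> 0" "\<epsilon> \<ge> 0"
    and der: "\<And>r. r \<in> {s..t} \<Longrightarrow> (e has_vector_derivative e' r) (at r within {s..t})"
    and bd: "\<And>r. r \<in> {s..t} \<Longrightarrow> norm (e' r) \<le> K * norm (e r) + \<epsilon>"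
  shows "(norm (e t))\<^sup>2 \<le> ((norm (e s))\<^sup>2 + \<epsilon>\<^sup>2) * exp ((2 * K + 1) * (t - s))"
proof -
  define C where "C = 2 * K + 1"
  define y where "y r = (e r \<bullet> e r + \<epsilon>\<^sup>2) * exp (- C * (r - s))" for r
  have "y t \<le> y s"
  proof (rule antitone_of_nonpos_derivative[OF \<open>s \<le> t\<close>,
        where f' = "\<lambda>r. (2 * (e r \<bullet> e' r) - C * (e r \<bullet> e r + \<epsilon>\<^sup>2)) * exp (- C * (r - s))"])
    fix r assume r: "r \<in> {s..t}"
    show "(y has_real_derivative (2 * (e r \<bullet> e' r) - C * (e r \<bullet> e r + \<epsilon>\<^sup>2)) * exp (- C * (r - s)))
        (at r within {s..t})"
      using der[OF r] unfolding y_def has_vector_derivative_def has_field_derivative_def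
      by (auto intro!: derivative_eq_intros simp: fun_eq_iff inner_commute algebra_simps)
    have "e r \<bullet> e' r \<le> norm (e r) * norm (e' r)"
      by (rule norm_cauchy_schwarz)
    also have "\<dots> \<le> norm (e r) * (K * norm (e r) + \<epsilon>)"
      by (intro mult_left_mono bd r) simp
    finally have "2 * (e r \<bullet> e' r) \<le> 2 * K * (norm (e r))\<^sup>2 + 2 * norm (e r) * \<epsilon>"
      by (simp add: power2_eq_square algebra_simps)
    also have "2 * norm (e r) * \<epsilon> \<le> (norm (e r))\<^sup>2 + \<epsilon>\<^sup>2"
      using sum_squares_bound by blast
    finally have "2 * (e r \<bullet> e' r) \<le> C * (e r \<bullet> e r) + \<epsilon>\<^sup>2"
      by (simp add: C_def power2_norm_eq_inner[symmetric] algebra_simps)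
    moreover have "\<epsilon>\<^sup>2 \<le> C * \<epsilon>\<^sup>2"
      using \<open>K \<ge> 0\<close> by (simp add: C_def mult_le_cancel_right1)
    ultimately have "2 * (e r \<bullet> e' r) - C * (e r \<bullet> e r + \<epsilon>\<^sup>2) \<le> 0"
      by (simp add: algebra_simps)
    then show "(2 * (e r \<bullet> e' r) - C * (e r \<bullet> e r + \<epsilon>\<^sup>2)) * exp (- C * (r - s)) \<le> 0"
      by (simp add: mult_nonpos_nonneg)
  qed
  then have "(e t \<bullet> e t + \<epsilon>\<^sup>2) * exp (- C * (t - s)) * exp (C * (t - s)) \<le> (e s \<bullet> e s + \<epsilon>\<^sup>2) * exp (C * (t - s))"
    by (intro mult_right_mono) (simp_all add: y_def)
  then have "e t \<bullet> e t + \<epsilon>\<^sup>2 \<le> (e s \<bullet> e s + \<epsilon>\<^sup>2) * exp (C * (t - s))"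
    by (simp add: mult.assoc flip: exp_add)
  then show ?thesis
    by (simp add: C_def power2_norm_eq_inner) (smt (verit) zero_le_power2)
qed

text \<open>The forward estimate in reversed time. It is what makes the flow injective.\<close>

lemma gronwall_backward:
  fixes e :: "real \<Rightarrow> 'a::real_inner"
  assumes "s \<le> t" "K \<ge> 0"
    and der: "\<And>r. r \<in> {s..t} \<Longrightarrow> (e has_vector_derivative e' r) (at r within {s..t})"
    and bd: "\<And>r. r \<in> {s..t} \<Longrightarrow> norm (e' r) \<le> K * norm (e r)"
  shows "(norm (e s))\<^sup>2 \<le> (norm (e t))\<^sup>2 * exp ((2 * K + 1) * (t - s))"
proof -
  have im: "(\<lambda>r. s + t - r) ` {s..t} = {s..t}"
    by (auto simp: image_iff intro!: bexI[where x = "s + t - _"])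
  have "((\<lambda>r. e (s + t - r)) has_vector_derivative - e' (s + t - r)) (at r within {s..t})"
    if r: "r \<in> {s..t}" for r
  proof -
    have "((\<lambda>r. s + t - r) has_real_derivative - 1) (at r within {s..t})"
      by (auto intro!: derivative_eq_intros)
    moreover have "(e has_vector_derivative e' (s + t - r)) (at (s + t - r) within (\<lambda>r. s + t - r) ` {s..t})"
      unfolding im using r by (intro der) auto
    ultimately show ?thesis
      using vector_diff_chain_within[of "\<lambda>r. s + t - r" "-1" r "{s..t}" e "e' (s + t - r)"]
      by (simp add: has_real_derivative_iff_has_vector_derivative o_def)
  qed
  moreover have "norm (- e' (s + t - r)) \<le> K * norm (e (s + t - r)) + 0" if "r \<in> {s..t}" for r
    using bd[of "s + t - r"] that by auto
  ultimately show ?thesis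
    using gronwall_forward[of s t K 0 "\<lambda>r. e (s + t - r)" "\<lambda>r. - e' (s + t - r)"] assms(1,2) by auto
qed

lemma integral_exp_le:
  fixes \<alpha> :: real
  assumes "\<alpha> > 0" "a \<le> t"
  shows "(\<lambda>r. exp (\<alpha> * (r - a))) integrable_on {a..t}"
    and "integral {a..t} (\<lambda>r. exp (\<alpha> * (r - a))) \<le> exp (\<alpha> * (t - a)) / \<alpha>"
proof -
  have "((\<lambda>r. exp (\<alpha> * (r - a))) has_integral exp (\<alpha> * (t - a)) / \<alpha> - exp (\<alpha> * (a - a)) / \<alpha>) {a..t}"
    by (rule fundamental_theorem_of_calculus)
       (use assms in \<open>auto intro!: derivative_eq_intros simp flip: has_real_derivative_iff_has_vector_derivative\<close>)
  then show "(\<lambda>r. exp (\<alpha> * (r - a))) integrable_on {a..t}"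
    "integral {a..t} (\<lambda>r. exp (\<alpha> * (r - a))) \<le> exp (\<alpha> * (t - a)) / \<alpha>"
    using assms by (auto simp: has_integral_iff)
qed

text \<open>A solution on the whole interval comes from a single application of the contraction principle:
  the unknown is \<open>exp (- \<alpha> (t - a))\<close> times the solution, and for \<open>\<alpha> = 2 (\<bar>K\<bar> + 1)\<close> this weight makes the
  integral operator a contraction with constant one half whatever the length of the interval.
  Arguments are clamped to \<open>{a..b}\<close>, because the fixed point is sought among bounded continuous
  functions on the whole line.\<close>

lemma picard_lindelof:
  fixes V :: "real \<Rightarrow> 'a::banach \<Rightarrow> 'a"
  assumes ab: "a \<le> b"
    and cont: "continuous_on ({a..b} \<times> UNIV) (\<lambda>p. V (fst p) (snd p))"
    and lip: "\<And>t x y. t \<in> {a..b} \<Longrightarrow> norm (V t x - V t y) \<le> K * norm (x - y)"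
  shows "\<exists>\<phi>. \<phi> a = x0 \<and> (\<forall>t\<in>{a..b}. (\<phi> has_vector_derivative V t (\<phi> t)) (at t within {a..b}))"
proof -
  define \<alpha> where "\<alpha> = 2 * (\<bar>K\<bar> + 1)"
  have \<alpha>: "\<alpha> > 0" "\<bar>K\<bar> / \<alpha> \<le> 1/2" by (auto simp: \<alpha>_def field_simps)
  define c where "c s = max a (min b s)" for s
  have c: "c s \<in> {a..b}" for s using ab by (auto simp: c_def)
  have c_id: "c s = s" if "s \<in> {a..b}" for s using that by (auto simp: c_def)
  define W where "W \<psi> r = V r (exp (\<alpha> * (r - a)) *\<^sub>R apply_bcontfun \<psi> r)" for \<psi> r
  define Q where "Q \<psi> t = exp (- \<alpha> * (t - a)) *\<^sub>R (x0 + integral {a..t} (W \<psi>))" for \<psi> t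
  have contW: "continuous_on {a..b} (W \<psi>)" for \<psi>
    unfolding W_def
    by (rule continuous_on_compose2[OF cont, of _ "\<lambda>r. (r, exp (\<alpha> * (r - a)) *\<^sub>R apply_bcontfun \<psi> r)", simplified])
       (auto intro!: continuous_intros)
  have contQ: "continuous_on {a..b} (Q \<psi>)" for \<psi>
    unfolding Q_def
    by (intro continuous_intros indefinite_integral_continuous_1 integrable_continuous_real contW)
  have bc: "(\<lambda>s. Q \<psi> (c s)) \<in> bcontfun" for \<psi>
  proof -
    have "continuous_on UNIV (\<lambda>s. Q \<psi> (c s))"
      by (rule continuous_on_compose2[OF contQ]) (auto simp: c_def ab intro!: continuous_intros)
    moreover have "bounded (range (\<lambda>s. Q \<psi> (c s)))"
      by (rule bounded_subset[OF compact_imp_bounded[OF compact_continuous_image[OF contQ[of \<psi>] compact_Icc]]])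
         (use c in blast)
    ultimately show ?thesis by (simp add: bcontfun_def)
  qed
  define F where "F \<psi> = Bcontfun (\<lambda>s. Q \<psi> (c s))" for \<psi>
  have F: "apply_bcontfun (F \<psi>) s = Q \<psi> (c s)" for \<psi> s
    unfolding F_def using bc by (simp add: Bcontfun_inverse)
  have "dist (F \<psi>1) (F \<psi>2) \<le> 1/2 * dist \<psi>1 \<psi>2" for \<psi>1 \<psi>2
  proof (rule dist_bound)
    fix s
    define t where "t = c s"
    have t: "t \<in> {a..b}" unfolding t_def by (rule c)
    have sub: "{a..t} \<subseteq> {a..b}" using t by auto
    have int: "W \<psi> integrable_on {a..t}" for \<psi>
      by (intro integrable_continuous_real continuous_on_subset[OF contW sub])
    let ?E = "\<lambda>r. exp (\<alpha> * (r - a))"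
    have "Q \<psi>1 t - Q \<psi>2 t = exp (- \<alpha> * (t - a)) *\<^sub>R integral {a..t} (\<lambda>r. W \<psi>1 r - W \<psi>2 r)"
      unfolding Q_def by (simp add: integral_diff[OF int int] flip: scaleR_diff_right)
    then have "norm (Q \<psi>1 t - Q \<psi>2 t) = exp (- \<alpha> * (t - a)) * norm (integral {a..t} (\<lambda>r. W \<psi>1 r - W \<psi>2 r))"
      by simp
    also have "norm (integral {a..t} (\<lambda>r. W \<psi>1 r - W \<psi>2 r)) \<le> integral {a..t} (\<lambda>r. (\<bar>K\<bar> * dist \<psi>1 \<psi>2) * ?E r)"
    proof (rule integral_norm_bound_integral)
      show "(\<lambda>r. W \<psi>1 r - W \<psi>2 r) integrable_on {a..t}" by (intro integrable_diff int)
      show "(\<lambda>r. (\<bar>K\<bar> * dist \<psi>1 \<psi>2) * ?E r) integrable_on {a..t}"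
        using integral_exp_le(1)[OF \<alpha>(1), of a t] t by (intro integrable_on_mult_right) auto
      fix r assume r: "r \<in> {a..t}"
      have "norm (W \<psi>1 r - W \<psi>2 r) \<le> K * norm (?E r *\<^sub>R \<psi>1 r - ?E r *\<^sub>R \<psi>2 r)"
        unfolding W_def by (rule lip) (use r sub in auto)
      also have "\<dots> = K * (?E r * dist (\<psi>1 r) (\<psi>2 r))"
        by (simp add: dist_norm flip: scaleR_diff_right)
      also have "\<dots> \<le> \<bar>K\<bar> * (?E r * dist \<psi>1 \<psi>2)"
        by (intro mult_mono mult_left_mono dist_bounded) auto
      finally show "norm (W \<psi>1 r - W \<psi>2 r) \<le> (\<bar>K\<bar> * dist \<psi>1 \<psi>2) * ?E r" by (simp add: mult_ac)
    qed
    also have "\<dots> = (\<bar>K\<bar> * dist \<psi>1 \<psi>2) * integral {a..t} ?E"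
      by simp
    also have "\<dots> \<le> (\<bar>K\<bar> * dist \<psi>1 \<psi>2) * (exp (\<alpha> * (t - a)) / \<alpha>)"
      by (intro mult_left_mono integral_exp_le \<alpha>) (use t in auto)
    also have "exp (- \<alpha> * (t - a)) * \<dots> = \<bar>K\<bar> / \<alpha> * dist \<psi>1 \<psi>2"
    proof -
      have "exp (- \<alpha> * (t - a)) * exp (\<alpha> * (t - a)) = 1" by (simp flip: exp_add)
      then show ?thesis by (simp add: mult_ac)
    qed
    also have "\<dots> \<le> 1/2 * dist \<psi>1 \<psi>2"
      by (intro mult_right_mono \<alpha>) simp
    finally show "dist (F \<psi>1 s) (F \<psi>2 s) \<le> 1/2 * dist \<psi>1 \<psi>2"
      by (simp add: F dist_norm t_def[symmetric])
  qed
  then obtain \<psi> where \<psi>: "F \<psi> = \<psi>"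
    using banach_fix_type[of "1/2" F] by auto
  define \<phi> where "\<phi> t = x0 + integral {a..t} (W \<psi>)" for t
  have eq: "V t (\<phi> t) = W \<psi> t" if "t \<in> {a..b}" for t
  proof -
    have "apply_bcontfun \<psi> t = exp (- \<alpha> * (t - a)) *\<^sub>R \<phi> t"
      using F[of \<psi> t] that by (simp add: \<psi> Q_def \<phi>_def c_id)
    then show ?thesis by (simp add: W_def flip: exp_add)
  qed
  have "(\<phi> has_vector_derivative V t (\<phi> t)) (at t within {a..b})" if "t \<in> {a..b}" for t
    unfolding eq[OF that] unfolding \<phi>_def
    by (rule has_vector_derivative_eq_rhs)
       (rule has_vector_derivative_add[OF has_vector_derivative_const integral_has_vector_derivative[OF contW that]], simp)
  moreover have "\<phi> a = x0" by (simp add: \<phi>_def)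
  ultimately show ?thesis by blast
qed


text \<open>The bound \<open>K\<close> on the spatial derivative is global, so the solutions exist up to time \<open>b\<close> for every
  initial point of the space.\<close>

locale c1_field =
  fixes a b K :: real
    and V :: "real \<Rightarrow> 'a::euclidean_space \<Rightarrow> 'a"
    and DV :: "real \<Rightarrow> 'a \<Rightarrow> 'a \<Rightarrow>\<^sub>L 'a"
  assumes ab: "a \<le> b"
    and cont_V: "continuous_on ({a..b} \<times> UNIV) (\<lambda>p. V (fst p) (snd p))"
    and deriv_V: "\<And>t x. t \<in> {a..b} \<Longrightarrow> (V t has_derivative DV t x) (at x)"
    and cont_DV: "continuous_on ({a..b} \<times> UNIV) (\<lambda>p. DV (fst p) (snd p))"
    and bound_DV: "\<And>t x. t \<in> {a..b} \<Longrightarrow> norm (DV t x) \<le> K"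
begin

lemma K_nonneg: "K \<ge> 0"
  using order_trans[OF norm_ge_zero bound_DV[of a]] ab by simp

lemma lipschitz_V: "t \<in> {a..b} \<Longrightarrow> norm (V t x - V t y) \<le> K * norm (x - y)"
  by (rule differentiable_bound[of UNIV _ "\<lambda>x. blinfun_apply (DV t x)"])
     (use deriv_V bound_DV in \<open>auto simp: norm_blinfun.rep_eq[symmetric]\<close>)

definition "solution \<phi> \<longleftrightarrow> (\<forall>t\<in>{a..b}. (\<phi> has_vector_derivative V t (\<phi> t)) (at t within {a..b}))"

definition "growth = sqrt (exp ((2 * K + 1) * (b - a)))"

lemma growth_pos: "growth > 0" by (simp add: growth_def)

lemma exp_le_growth:
  "t \<in> {a..b} \<Longrightarrow> s \<in> {a..b} \<Longrightarrow> exp ((2 * K + 1) * (t - s)) \<le> growth\<^sup>2"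
  using K_nonneg by (auto simp: growth_def intro!: mult_left_mono)

text \<open>The form of the forward estimate for differences that start at zero: \<open>growth\<close> bounds the
  exponential factor uniformly on the interval.\<close>

lemma gronwall_growth:
  assumes "t \<in> {a..b}" "\<epsilon> \<ge> 0" "e a = 0"
    and "\<And>r. r \<in> {a..b} \<Longrightarrow> (e has_vector_derivative e' r) (at r within {a..b})"
    and "\<And>r. r \<in> {a..b} \<Longrightarrow> norm (e' r) \<le> K * norm (e r) + \<epsilon>"
  shows "norm (e t :: 'a) \<le> growth * \<epsilon>"
proof -
  have sub: "{a..t} \<subseteq> {a..b}" using assms(1) by auto
  have "(norm (e t))\<^sup>2 \<le> ((norm (e a))\<^sup>2 + \<epsilon>\<^sup>2) * exp ((2 * K + 1) * (t - a))"
    by (rule gronwall_forward[OF _ K_nonneg \<open>\<epsilon> \<ge> 0\<close>, where e' = e'])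
       (use assms sub has_vector_derivative_within_subset[OF assms(4) sub] in auto)
  also have "\<dots> \<le> ((norm (e a))\<^sup>2 + \<epsilon>\<^sup>2) * growth\<^sup>2"
    by (intro mult_left_mono exp_le_growth) (use assms ab in auto)
  finally have "(norm (e t))\<^sup>2 \<le> (growth * \<epsilon>)\<^sup>2" by (simp add: assms(3) power_mult_distrib mult_ac)
  then show ?thesis
    by (rule power2_le_imp_le) (use growth_pos \<open>\<epsilon> \<ge> 0\<close> in simp)
qed

lemma solution_dist:
  assumes "solution \<phi>" "solution \<psi>" "s \<in> {a..b}" "t \<in> {a..b}"
  shows "norm (\<phi> t - \<psi> t) \<le> growth * norm (\<phi> s - \<psi> s)"
proof -
  define e where "e r = \<phi> r - \<psi> r" for r
  have der: "(e has_vector_derivative V r (\<phi> r) - V r (\<psi> r)) (at r within S)"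
    if "r \<in> {a..b}" "S \<subseteq> {a..b}" for r S
    unfolding e_def using assms(1,2) that(1) unfolding solution_def
    by (intro has_vector_derivative_diff has_vector_derivative_within_subset[OF _ that(2)]) auto
  have bd: "norm (V r (\<phi> r) - V r (\<psi> r)) \<le> K * norm (e r)" if "r \<in> {a..b}" for r
    unfolding e_def using that by (rule lipschitz_V)
  have "(norm (e t))\<^sup>2 \<le> (norm (e s))\<^sup>2 * growth\<^sup>2"
  proof (cases "s \<le> t")
    case True
    have "(norm (e t))\<^sup>2 \<le> ((norm (e s))\<^sup>2 + 0\<^sup>2) * exp ((2 * K + 1) * (t - s))"
      by (rule gronwall_forward[OF True K_nonneg order_refl, where e' = "\<lambda>r. V r (\<phi> r) - V r (\<psi> r)"])
         (use assms der bd in auto)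
    also have "\<dots> \<le> ((norm (e s))\<^sup>2 + 0\<^sup>2) * growth\<^sup>2"
      by (intro mult_left_mono exp_le_growth) (use assms in auto)
    finally show ?thesis by simp
  next
    case False
    then have "(norm (e t))\<^sup>2 \<le> (norm (e s))\<^sup>2 * exp ((2 * K + 1) * (s - t))"
      by (intro gronwall_backward[OF _ K_nonneg, where e' = "\<lambda>r. V r (\<phi> r) - V r (\<psi> r)"])
         (use assms der bd in auto)
    also have "\<dots> \<le> (norm (e s))\<^sup>2 * growth\<^sup>2"
      by (intro mult_left_mono exp_le_growth) (use assms in auto)
    finally show ?thesis .
  qed
  then have "(norm (e t))\<^sup>2 \<le> (growth * norm (e s))\<^sup>2" by (simp add: power_mult_distrib mult_ac)
  then show ?thesis
    unfolding e_def by (rule power2_le_imp_le) (use growth_pos in simp)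
qed

definition "flow t x = (SOME \<phi>. \<phi> a = x \<and> solution \<phi>) t"

lemma flow_init: "flow a x = x" and flow_solution: "solution (\<lambda>t. flow t x)"
proof -
  have "\<exists>\<phi>. \<phi> a = x \<and> solution \<phi>"
    unfolding solution_def by (rule picard_lindelof[OF ab cont_V lipschitz_V])
  from someI_ex[OF this] show "flow a x = x" "solution (\<lambda>t. flow t x)"
    unfolding flow_def by auto
qed

lemma flow_unique:
  assumes "solution \<phi>" "t \<in> {a..b}"
  shows "\<phi> t = flow t (\<phi> a)"
  using solution_dist[OF assms(1) flow_solution, of a t "\<phi> a"] assms ab by (simp add: flow_init)

lemma flow_lipschitz: "t \<in> {a..b} \<Longrightarrow> norm (flow t x - flow t y) \<le> growth * norm (x - y)"
  using solution_dist[OF flow_solution flow_solution, of a t x y] ab by (simp add: flow_init)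

lemma flow_injective: "t \<in> {a..b} \<Longrightarrow> flow t x = flow t y \<Longrightarrow> x = y"
  using solution_dist[OF flow_solution flow_solution, of t a x y] ab by (simp add: flow_init)

lemma flow_continuous_time: "continuous_on {a..b} (\<lambda>t. flow t x)"
  using flow_solution[of x] unfolding solution_def
  by (meson continuous_on_eq_continuous_within has_vector_derivative_continuous)

lemma flow_continuous: "continuous_on ({a..b} \<times> UNIV) (\<lambda>p. flow (fst p) (snd p))"
  unfolding continuous_on_def
proof
  fix p :: "real \<times> 'a" assume p: "p \<in> {a..b} \<times> UNIV"
  let ?F = "at p within {a..b} \<times> UNIV"
  have fs: "(fst \<longlongrightarrow> fst p) ?F" "(snd \<longlongrightarrow> snd p) ?F" by (auto intro!: tendsto_intros)
  have "((\<lambda>q. flow (fst q) (snd q) - flow (fst q) (snd p)) \<longlongrightarrow> 0) ?F"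
  proof (rule Lim_null_comparison)
    show "\<forall>\<^sub>F q in ?F. norm (flow (fst q) (snd q) - flow (fst q) (snd p)) \<le> growth * norm (snd q - snd p)"
      by (auto simp: eventually_at_filter flow_lipschitz intro!: always_eventually)
    show "((\<lambda>q. growth * norm (snd q - snd p)) \<longlongrightarrow> 0) ?F"
      by (auto intro!: tendsto_eq_intros fs)
  qed
  moreover have "((\<lambda>q. flow (fst q) (snd p)) \<longlongrightarrow> flow (fst p) (snd p)) ?F"
  proof -
    have "continuous_on ({a..b} \<times> UNIV) (\<lambda>q::real \<times> 'a. flow (fst q) (snd p))"
      by (rule continuous_on_compose2[OF flow_continuous_time]) (auto intro!: continuous_intros)
    with p show ?thesis unfolding continuous_on_def by blast
  qed
  ultimately show "((\<lambda>q. flow (fst q) (snd q)) \<longlongrightarrow> flow (fst p) (snd p)) ?F"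
    using tendsto_add by fastforce
qed

text \<open>The candidate for the spatial derivative of the flow in direction \<open>h\<close>: the solution of the
  equation linearized along the trajectory of \<open>x\<close>.\<close>

definition "dflow t x h = (SOME m. m a = h \<and>
  (\<forall>s\<in>{a..b}. (m has_vector_derivative DV s (flow s x) (m s)) (at s within {a..b}))) t"

lemma cont_DV_flow: "continuous_on {a..b} (\<lambda>s. DV s (flow s x))"
  by (rule continuous_on_compose2[OF cont_DV, of _ "\<lambda>s. (s, flow s x)", simplified])
     (auto intro!: continuous_intros flow_continuous_time)

lemma DV_le: "t \<in> {a..b} \<Longrightarrow> norm (DV t x m) \<le> K * norm m"
  using norm_blinfun[of "DV t x" m] mult_right_mono[OF bound_DV norm_ge_zero] order_trans by blast

lemma dflow_init: "dflow a x h = h"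
  and dflow_deriv: "\<And>s. s \<in> {a..b} \<Longrightarrow>
    ((\<lambda>s. dflow s x h) has_vector_derivative DV s (flow s x) (dflow s x h)) (at s within {a..b})"
proof -
  have "continuous_on ({a..b} \<times> UNIV) (\<lambda>p. DV (fst p) (flow (fst p) x) (snd p))"
    by (intro bounded_bilinear.continuous_on[OF bounded_bilinear_blinfun_apply]
          continuous_on_compose2[OF cont_DV_flow] continuous_intros) auto
  then have "\<exists>m. m a = h \<and>
      (\<forall>s\<in>{a..b}. (m has_vector_derivative DV s (flow s x) (m s)) (at s within {a..b}))"
    by (rule picard_lindelof[OF ab, where K = K]) (use DV_le in \<open>auto simp flip: blinfun.diff_right\<close>)
  from someI_ex[OF this] show "dflow a x h = h" "\<And>s. s \<in> {a..b} \<Longrightarrow>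
      ((\<lambda>s. dflow s x h) has_vector_derivative DV s (flow s x) (dflow s x h)) (at s within {a..b})"
    unfolding dflow_def by auto
qed

lemma dflow_unique:
  assumes "m a = h"
    and "\<And>s. s \<in> {a..b} \<Longrightarrow> (m has_vector_derivative DV s (flow s x) (m s)) (at s within {a..b})"
    and "t \<in> {a..b}"
  shows "m t = dflow t x h"
proof -
  have "norm (m t - dflow t x h) \<le> growth * 0"
    by (rule gronwall_growth[where e' = "\<lambda>s. DV s (flow s x) (m s) - DV s (flow s x) (dflow s x h)"])
       (use assms dflow_init DV_le in
         \<open>auto intro!: has_vector_derivative_diff dflow_deriv simp flip: blinfun.diff_right\<close>,
        auto simp: blinfun.diff_right intro!: has_vector_derivative_diff dflow_deriv assms)
  then show ?thesis by simp
qed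

lemma dflow_linear: "t \<in> {a..b} \<Longrightarrow> linear (dflow t x)"
proof (rule linearI)
  assume t: "t \<in> {a..b}"
  fix h k and c :: real
  show "dflow t x (h + k) = dflow t x h + dflow t x k"
    by (rule dflow_unique[symmetric, where m = "\<lambda>t. dflow t x h + dflow t x k", OF _ _ t])
       (auto simp: dflow_init blinfun.add_right intro!: has_vector_derivative_add dflow_deriv)
  show "dflow t x (c *\<^sub>R h) = c *\<^sub>R dflow t x h"
    by (rule dflow_unique[symmetric, where m = "\<lambda>t. c *\<^sub>R dflow t x h", OF _ _ t])
       (auto simp: dflow_init blinfun.scaleR_right intro!: derivative_eq_intros dflow_deriv)
qed

text \<open>The trajectory of \<open>x\<close> stays in a compact set, so the continuity of \<open>DV\<close> along it is uniform
  in time.\<close>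

lemma DV_modulus:
  assumes "\<epsilon> > 0"
  obtains \<delta> where "\<delta> > 0"
    "\<And>t y. t \<in> {a..b} \<Longrightarrow> norm (y - flow t x) < \<delta> \<Longrightarrow> norm (DV t y - DV t (flow t x)) \<le> \<epsilon>"
proof -
  obtain M where M: "\<And>t. t \<in> {a..b} \<Longrightarrow> norm (flow t x) \<le> M"
    using compact_imp_bounded[OF compact_continuous_image[OF flow_continuous_time[of x] compact_Icc]]
    unfolding bounded_iff by blast
  have "uniformly_continuous_on ({a..b} \<times> cball 0 (M + 1)) (\<lambda>p. DV (fst p) (snd p))"
    by (intro compact_uniformly_continuous compact_Times compact_Icc compact_cball
        continuous_on_subset[OF cont_DV]) auto
  then obtain \<delta> where \<delta>: "\<delta> > 0" "\<And>p q. p \<in> {a..b} \<times> cball 0 (M + 1) \<Longrightarrow> q \<in> {a..b} \<times> cball 0 (M + 1) \<Longrightarrow>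
      dist q p < \<delta> \<Longrightarrow> dist (DV (fst q) (snd q)) (DV (fst p) (snd p)) < \<epsilon>"
    using assms unfolding uniformly_continuous_on_def by blast
  have "norm (DV t y - DV t (flow t x)) \<le> \<epsilon>" if "t \<in> {a..b}" "norm (y - flow t x) < min \<delta> 1" for t y
  proof -
    have "norm y \<le> M + 1"
      using M[OF that(1)] norm_triangle_sub[of y "flow t x"] that(2) by linarith
    then show ?thesis
      using \<delta>(2)[of "(t, flow t x)" "(t, y)"] that M[OF that(1)] by (simp add: dist_norm dist_Pair_Pair)
  qed
  with \<delta>(1) show ?thesis by (intro that[of "min \<delta> 1"]) auto
qed

text \<open>The error of the linear approximation satisfies the linearized equation up to a defect, the
  first-order Taylor error of \<open>V\<close> along the trajectory. By \<open>DV_modulus\<close> the defect is a small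
  multiple of the distance of the two trajectories, hence of \<open>\<bar>y - x\<bar>\<close>, and \<open>gronwall_growth\<close>
  transfers this to the error.\<close>

lemma flow_has_derivative:
  assumes t: "t \<in> {a..b}"
  shows "(flow t has_derivative dflow t x) (at x)"
  unfolding has_derivative_at_alt
proof (intro conjI allI impI)
  show "bounded_linear (dflow t x)" using dflow_linear[OF t] by (rule linear_linear[THEN iffD2])
  fix \<epsilon> :: real assume "\<epsilon> > 0"
  define \<epsilon>' where "\<epsilon>' = \<epsilon> / growth\<^sup>2"
  have "\<epsilon>' > 0" using \<open>\<epsilon> > 0\<close> growth_pos by (simp add: \<epsilon>'_def)
  then obtain \<delta> where \<delta>: "\<delta> > 0"
    "\<And>t y. t \<in> {a..b} \<Longrightarrow> norm (y - flow t x) < \<delta> \<Longrightarrow> norm (DV t y - DV t (flow t x)) \<le> \<epsilon>'"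
    by (rule DV_modulus[of _ x]) blast
  have "norm (flow t y - flow t x - dflow t x (y - x)) \<le> \<epsilon> * norm (y - x)"
    if y: "norm (y - x) < \<delta> / growth" for y
  proof -
    define d where "d s = flow s y - flow s x" for s
    have d: "norm (d s) \<le> growth * norm (y - x)" "norm (d s) < \<delta>" if "s \<in> {a..b}" for s
      using flow_lipschitz[OF that, of y x] y growth_pos by (auto simp: d_def field_simps)
    have "norm (d t - dflow t x (y - x)) \<le> growth * (\<epsilon>' * (growth * norm (y - x)))"
    proof (rule gronwall_growth[OF t, where e' = "\<lambda>s. (V s (flow s y) - V s (flow s x)) - DV s (flow s x) (dflow s x (y - x))"])
      show "0 \<le> \<epsilon>' * (growth * norm (y - x))" using \<open>\<epsilon>' > 0\<close> growth_pos by simp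
      show "d a - dflow a x (y - x) = 0" by (simp add: d_def flow_init dflow_init)
      fix s assume s: "s \<in> {a..b}"
      show "((\<lambda>t. d t - dflow t x (y - x)) has_vector_derivative
          (V s (flow s y) - V s (flow s x)) - DV s (flow s x) (dflow s x (y - x))) (at s within {a..b})"
        unfolding d_def using flow_solution s
        by (auto intro!: has_vector_derivative_diff dflow_deriv simp: solution_def)
      \<comment> \<open>The Taylor error is bounded by the oscillation of \<open>DV\<close> on the ball that contains both
        trajectories at time \<open>s\<close>.\<close>
      have "norm (V s (flow s y) - V s (flow s x) - DV s (flow s x) (flow s y - flow s x))
          \<le> norm (flow s y - flow s x) * \<epsilon>'"
      proof (rule differentiable_bound_linearization[where S = "ball (flow s x) \<delta>" and f' = "\<lambda>x. blinfun_apply (DV s x)"])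
        show "flow s x + r *\<^sub>R (flow s y - flow s x) \<in> ball (flow s x) \<delta>" if "r \<in> {0..1}" for r
        proof -
          have "norm (r *\<^sub>R d s) \<le> 1 * norm (d s)"
            unfolding norm_scaleR using that by (intro mult_right_mono) auto
          then show ?thesis using d(2)[OF s] by (simp add: d_def dist_norm)
        qed
        show "(V s has_derivative blinfun_apply (DV s z)) (at z within ball (flow s x) \<delta>)" for z
          using deriv_V[OF s] has_derivative_at_withinI by blast
        show "onorm (blinfun_apply (DV s z) - blinfun_apply (DV s (flow s x))) \<le> \<epsilon>'" if "z \<in> ball (flow s x) \<delta>" for z
          using \<delta>(2)[OF s, of z] that
          by (simp add: dist_norm norm_minus_commute norm_blinfun.rep_eq minus_blinfun.rep_eq fun_diff_def)
      qed (use \<delta> in auto)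
      also have "\<dots> \<le> (growth * norm (y - x)) * \<epsilon>'"
        using d(1)[OF s] \<open>\<epsilon>' > 0\<close> by (intro mult_right_mono) (auto simp: d_def)
      finally have 1: "norm (V s (flow s y) - V s (flow s x) - DV s (flow s x) (d s)) \<le> \<epsilon>' * (growth * norm (y - x))"
        by (simp add: mult_ac d_def)
      have 2: "norm (DV s (flow s x) (d s - dflow s x (y - x))) \<le> K * norm (d s - dflow s x (y - x))"
        by (rule DV_le[OF s])
      have eq: "V s (flow s y) - V s (flow s x) - DV s (flow s x) (dflow s x (y - x)) =
          DV s (flow s x) (d s - dflow s x (y - x)) + (V s (flow s y) - V s (flow s x) - DV s (flow s x) (d s))"
        by (simp add: blinfun.diff_right)
      show "norm (V s (flow s y) - V s (flow s x) - DV s (flow s x) (dflow s x (y - x))) \<le>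
          K * norm (d s - dflow s x (y - x)) + \<epsilon>' * (growth * norm (y - x))"
        unfolding eq by (rule norm_triangle_le[OF add_mono[OF 2 1]])
    qed
    also have "\<dots> = \<epsilon> * norm (y - x)"
      using growth_pos by (simp add: \<epsilon>'_def power2_eq_square)
    finally show ?thesis by (simp add: d_def)
  qed
  then show "\<exists>d>0. \<forall>y. norm (y - x) < d \<longrightarrow>
      norm (flow t y - flow t x - dflow t x (y - x)) \<le> \<epsilon> * norm (y - x)"
    using \<delta>(1) growth_pos by (intro exI[of _ "\<delta> / growth"]) auto
qed

text \<open>Two solutions of the linearized equation along neighbouring trajectories differ by a solution of
  it with a defect, which is small by \<open>DV_modulus\<close>.\<close>

lemma dflow_continuous:
  assumes t: "t \<in> {a..b}"
  shows "continuous_on UNIV (\<lambda>x. dflow t x h)"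
  unfolding continuous_on_iff
proof (intro ballI allI impI)
  fix x and \<epsilon> :: real assume "\<epsilon> > 0"
  have "continuous_on {a..b} (\<lambda>s. dflow s x h)"
    using dflow_deriv by (meson continuous_on_eq_continuous_within has_vector_derivative_continuous)
  then obtain M where M: "\<And>s. s \<in> {a..b} \<Longrightarrow> norm (dflow s x h) \<le> M"
    using compact_imp_bounded[OF compact_continuous_image[OF _ compact_Icc, of a b "\<lambda>s. dflow s x h"]]
    unfolding bounded_iff by blast
  have "M \<ge> 0" using M[OF t] norm_ge_zero order_trans by blast
  define \<epsilon>' where "\<epsilon>' = \<epsilon> / (2 * growth * (M + 1))"
  have "\<epsilon>' > 0" using \<open>\<epsilon> > 0\<close> growth_pos \<open>M \<ge> 0\<close> by (simp add: \<epsilon>'_def)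
  then obtain \<delta> where \<delta>: "\<delta> > 0"
    "\<And>t y. t \<in> {a..b} \<Longrightarrow> norm (y - flow t x) < \<delta> \<Longrightarrow> norm (DV t y - DV t (flow t x)) \<le> \<epsilon>'"
    by (rule DV_modulus[of _ x]) blast
  have "dist (dflow t y h) (dflow t x h) < \<epsilon>" if y: "dist y x < \<delta> / growth" for y
  proof -
    have near: "norm (flow s y - flow s x) < \<delta>" if "s \<in> {a..b}" for s
      using flow_lipschitz[OF that, of y x] y growth_pos by (auto simp: dist_norm field_simps)
    have "norm (dflow t y h - dflow t x h) \<le> growth * (\<epsilon>' * M)"
    proof (rule gronwall_growth[OF t, where e' = "\<lambda>s. DV s (flow s y) (dflow s y h) - DV s (flow s x) (dflow s x h)"])
      show "0 \<le> \<epsilon>' * M" using \<open>\<epsilon>' > 0\<close> \<open>M \<ge> 0\<close> by simp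
      show "dflow a y h - dflow a x h = 0" by (simp add: dflow_init)
      fix s assume s: "s \<in> {a..b}"
      show "((\<lambda>t. dflow t y h - dflow t x h) has_vector_derivative
          DV s (flow s y) (dflow s y h) - DV s (flow s x) (dflow s x h)) (at s within {a..b})"
        by (intro has_vector_derivative_diff dflow_deriv s)
      have "DV s (flow s y) (dflow s y h) - DV s (flow s x) (dflow s x h) =
          DV s (flow s y) (dflow s y h - dflow s x h) + (DV s (flow s y) - DV s (flow s x)) (dflow s x h)"
        by (simp add: blinfun.diff_right blinfun.diff_left)
      moreover have "norm (DV s (flow s y) (dflow s y h - dflow s x h)) \<le> K * norm (dflow s y h - dflow s x h)"
        by (rule DV_le[OF s])
      moreover have "norm ((DV s (flow s y) - DV s (flow s x)) (dflow s x h)) \<le> \<epsilon>' * M"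
        using norm_blinfun order_trans mult_mono[OF \<delta>(2)[OF s near[OF s]] M[OF s]] \<open>\<epsilon>' > 0\<close>
        by (smt (verit) norm_ge_zero)
      ultimately show "norm (DV s (flow s y) (dflow s y h) - DV s (flow s x) (dflow s x h)) \<le>
          K * norm (dflow s y h - dflow s x h) + \<epsilon>' * M"
        by (smt (verit) norm_triangle_ineq)
    qed
    also have "\<dots> = \<epsilon> * (M / (2 * (M + 1)))"
      using growth_pos by (simp add: \<epsilon>'_def)
    also have "\<dots> < \<epsilon> * 1"
      using \<open>M \<ge> 0\<close> \<open>\<epsilon> > 0\<close> by (intro mult_strict_left_mono) auto
    also have "\<dots> = \<epsilon>" by simp
    finally show ?thesis by (simp add: dist_norm)
  qed
  then show "\<exists>d>0. \<forall>y\<in>UNIV. dist y x < d \<longrightarrow> dist (dflow t y h) (dflow t x h) < \<epsilon>"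
    using \<delta>(1) growth_pos by (intro exI[of _ "\<delta> / growth"]) auto
qed

end

section \<open>Sobolev regularity of continuously differentiable maps\<close>

lemma integral_lborel_translate:
  fixes f :: "'a::euclidean_space \<Rightarrow> 'b::{banach, second_countable_topology}"
  assumes "f \<in> borel_measurable borel"
  shows "(\<integral>x. f (c + x) \<partial>lborel) = integral\<^sup>L lborel f"
proof -
  have "integral\<^sup>L (distr lborel borel ((+) c)) f = (\<integral>x. f (c + x) \<partial>lborel)"
    by (rule integral_distr) (use assms in auto)
  then show ?thesis by (simp add: lborel_distr_plus)
qed

text \<open>By translation invariance every difference quotient \<open>(f (x + h e) - f x) / h\<close> has integral zero,
  and dominated convergence passes to the limit \<open>h \<rightarrow> 0\<close>.\<close>

lemma integral_derivative_compact_support: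
  fixes f :: "'a::euclidean_space \<Rightarrow> real"
  assumes der: "\<And>x. (f has_derivative f' x) (at x)"
    and cont: "continuous_on UNIV (\<lambda>x. f' x e)"
    and "compact C" and supp: "\<And>x. x \<notin> C \<Longrightarrow> f x = 0"
  shows "(\<integral>x. f' x e \<partial>lborel) = 0"
proof -
  have contf: "continuous_on UNIV f"
    using der by (meson continuous_at_imp_continuous_on has_derivative_continuous)
  obtain M where M: "M > 0" "C \<subseteq> cball 0 M"
    using bounded_pos[of C] compact_imp_bounded[OF \<open>compact C\<close>] by (auto simp: subset_eq)
  \<comment> \<open>All quotients with \<open>0 < h \<le> 1\<close> vanish outside \<open>B\<close>, and the segments that the mean value
    theorem needs for points of \<open>B\<close> stay in the ball of radius \<open>M + 2 \<bar>e\<bar>\<close>.\<close>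
  define B where "B = cball (0::'a) (M + norm e)"
  obtain K where K: "\<And>x. x \<in> cball 0 (M + norm e + norm e) \<Longrightarrow> norm (f' x e) \<le> K"
    using compact_imp_bounded[OF compact_continuous_image[OF continuous_on_subset[OF cont] compact_cball]]
    unfolding bounded_iff by blast
  define h where "h n = 1 / real (Suc n)" for n
  have h: "h n > 0" "h n \<le> 1" for n by (auto simp: h_def)
  have h0: "h \<longlonglongrightarrow> 0" unfolding h_def by (rule LIMSEQ_Suc[OF lim_1_over_n])
  define q where "q n x = (f (h n *\<^sub>R e + x) - f x) / h n" for n x
  have line: "((\<lambda>s. f (s *\<^sub>R e + x)) has_real_derivative f' (s *\<^sub>R e + x) e) (at s within S)" for s x S
  proof -
    have "((\<lambda>s. s *\<^sub>R e + x) has_derivative (\<lambda>r. r *\<^sub>R e)) (at s within S)"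
      by (auto intro!: derivative_eq_intros)
    from has_derivative_compose[OF this der] have "((\<lambda>s. f (s *\<^sub>R e + x)) has_derivative (\<lambda>r. f' (s *\<^sub>R e + x) (r *\<^sub>R e))) (at s within S)" .
    then show ?thesis
      unfolding has_field_derivative_def
      by (rule has_derivative_eq_rhs)
         (use linear_cmul[OF has_derivative_linear[OF der]] in \<open>auto simp: fun_eq_iff\<close>)
  qed
  have out: "f (s *\<^sub>R e + x) = 0" if "x \<notin> B" "s \<in> {0..1}" for s x
  proof (rule supp, rule notI)
    assume "s *\<^sub>R e + x \<in> C"
    with M have "norm (s *\<^sub>R e + x) \<le> M" by auto
    moreover have "norm (s *\<^sub>R e) \<le> 1 * norm e"
      unfolding norm_scaleR using that by (intro mult_right_mono) auto
    ultimately have "norm x \<le> M + norm e"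
      using norm_triangle_ineq4[of "s *\<^sub>R e + x" "s *\<^sub>R e"] by simp
    with that show False by (simp add: B_def)
  qed
  have qbound: "norm (q n x) \<le> K * indicator B x" for n x
  proof (cases "x \<in> B")
    case True
    obtain s where s: "s \<in> {0..h n}" "f (h n *\<^sub>R e + x) - f (0 *\<^sub>R e + x) = f' (s *\<^sub>R e + x) e * (h n - 0)"
      using mvt_very_simple[of 0 "h n" "\<lambda>s. f (s *\<^sub>R e + x)" "\<lambda>s. (*) (f' (s *\<^sub>R e + x) e)"] line h(1)[of n]
      by (auto simp: has_field_derivative_def)
    have "norm (s *\<^sub>R e) \<le> 1 * norm e"
      unfolding norm_scaleR using s(1) h[of n] by (intro mult_right_mono) auto
    then have "norm (s *\<^sub>R e + x) \<le> M + norm e + norm e"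
      using True norm_triangle_ineq[of "s *\<^sub>R e" x] by (simp add: B_def)
    then have "norm (f' (s *\<^sub>R e + x) e) \<le> K" by (intro K) simp
    moreover have "q n x = f' (s *\<^sub>R e + x) e"
      using s(2) h(1)[of n] by (simp add: q_def)
    ultimately show ?thesis using True by simp
  next
    case False
    then show ?thesis using out[OF False, of "h n"] out[OF False, of 0] h[of n] by (simp add: q_def)
  qed
  have "(\<lambda>n. integral\<^sup>L lborel (q n)) \<longlonglongrightarrow> (\<integral>x. f' x e \<partial>lborel)"
  proof (rule integral_dominated_convergence[where w = "\<lambda>x. K * indicator B x"])
    show "(\<lambda>x. f' x e) \<in> borel_measurable lborel"
      using borel_measurable_continuous_onI[OF cont] by simp
    show "q n \<in> borel_measurable lborel" for n
      unfolding q_def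
      using h(1)[of n]
      by (auto intro!: borel_measurable_continuous_onI continuous_intros continuous_on_compose2[OF contf])
    show "integrable lborel (\<lambda>x. K * indicator B x)"
      unfolding B_def
      by (intro integrable_mult_right integrable_real_indicator emeasure_bounded_finite bounded_cball) simp
    show "AE x in lborel. (\<lambda>n. q n x) \<longlonglongrightarrow> f' x e"
    proof (rule AE_I2)
      fix x
      have "((\<lambda>s. (f (s *\<^sub>R e + x) - f (0 *\<^sub>R e + x)) / (s - 0)) \<longlongrightarrow> f' (0 *\<^sub>R e + x) e) (at 0)"
        using line[of x 0 UNIV] unfolding has_field_derivative_iff .
      moreover have "filterlim h (at 0) sequentially"
        using h0 h(1) by (auto simp: filterlim_at intro!: always_eventually) (metis less_irrefl)
      ultimately show "(\<lambda>n. q n x) \<longlonglongrightarrow> f' x e"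
        using filterlim_compose[of "\<lambda>s. (f (s *\<^sub>R e + x) - f (0 *\<^sub>R e + x)) / (s - 0)" _ "at 0" h sequentially]
        by (simp add: q_def)
    qed
    show "AE x in lborel. norm (q n x) \<le> K * indicator B x" for n
      using qbound by simp
  qed
  moreover have "integral\<^sup>L lborel (q n) = 0" for n
  proof -
    have m: "f \<in> borel_measurable borel" using contf by (rule borel_measurable_continuous_onI)
    have intg: "integrable lborel (\<lambda>x. f (s *\<^sub>R e + x))" if "s \<in> {0..1}" for s
    proof -
      have "continuous_on B (\<lambda>x. f (s *\<^sub>R e + x))"
        by (intro continuous_on_compose2[OF contf] continuous_intros) auto
      then have "integrable lborel (\<lambda>x. indicator B x *\<^sub>R f (s *\<^sub>R e + x))"
        by (intro borel_integrable_compact) (simp_all add: B_def)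
      moreover have "(\<lambda>x. indicator B x *\<^sub>R f (s *\<^sub>R e + x)) = (\<lambda>x. f (s *\<^sub>R e + x))"
        using out[OF _ that] by (auto simp: fun_eq_iff indicator_def)
      ultimately show ?thesis by simp
    qed
    have "integral\<^sup>L lborel (q n) = ((\<integral>x. f (h n *\<^sub>R e + x) \<partial>lborel) - (\<integral>x. f x \<partial>lborel)) / h n"
      unfolding q_def using intg[of "h n"] intg[of 0] h[of n]
      by (subst integral_divide_zero, subst Bochner_Integration.integral_diff) auto
    then show ?thesis using integral_lborel_translate[OF m] by simp
  qed
  ultimately show ?thesis by (simp add: LIMSEQ_const_iff)
qed

lemma test_function_deriv:
  assumes "test_function U \<phi>"
  shows "(\<phi> has_derivative frechet_derivative \<phi> (at x)) (at x)"
    and "continuous_on UNIV (\<lambda>x. frechet_derivative \<phi> (at x) (axis j 1))"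
proof -
  have "Ck (Suc 0) \<phi>" using assms unfolding test_function_def by blast
  then show "(\<phi> has_derivative frechet_derivative \<phi> (at x)) (at x)"
    "continuous_on UNIV (\<lambda>x. frechet_derivative \<phi> (at x) (axis j 1))"
    by (auto simp: frechet_derivative_works[symmetric])
qed

lemma integral_lebesgue_on_eq_lborel:
  fixes g :: "'a::euclidean_space \<Rightarrow> real"
  assumes "open U" and cont: "continuous_on UNIV g" and "\<And>x. x \<notin> U \<Longrightarrow> g x = 0"
  shows "integral\<^sup>L (lebesgue_on U) g = integral\<^sup>L lborel g"
proof -
  have "integral\<^sup>L (lebesgue_on U) g = (\<integral>x. indicator U x *\<^sub>R g x \<partial>lebesgue)"
    using \<open>open U\<close> by (subst integral_restrict_space) (auto simp: borel_open)
  also have "(\<lambda>x. indicator U x *\<^sub>R g x) = g"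
    using assms(3) by (auto simp: fun_eq_iff indicator_def)
  also have "integral\<^sup>L lebesgue g = integral\<^sup>L lborel g"
    by (rule integral_completion) (use borel_measurable_continuous_onI[OF cont] in simp)
  finally show ?thesis .
qed

lemma Lp_on_continuous:
  fixes f :: "'a::euclidean_space \<Rightarrow> 'b::euclidean_space"
  assumes "S \<in> sets lebesgue" "compact C" "S \<subseteq> C" "p > 0" and cont: "continuous_on C f"
  shows "Lp_on p S f"
proof -
  have S: "S \<in> lmeasurable"
    by (meson assms(1-3) bounded_set_imp_lmeasurable bounded_subset compact_imp_bounded)
  have C: "C \<in> sets lebesgue" using \<open>compact C\<close> by (simp add: borel_compact)
  have m: "f \<in> borel_measurable (lebesgue_on S)"
    using continuous_imp_measurable_on_sets_lebesgue[OF cont C]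
    by (meson assms(1,3) measurable_restrict_mono)
  obtain M where M: "\<And>x. x \<in> C \<Longrightarrow> norm (f x) \<le> M"
    using compact_imp_bounded[OF compact_continuous_image[OF cont \<open>compact C\<close>]]
    unfolding bounded_iff by blast
  interpret finite_measure "lebesgue_on S"
    using S by (rule finite_measure_lebesgue_on)
  have "integrable (lebesgue_on S) (\<lambda>x. norm (f x) powr p)"
  proof (rule integrable_const_bound[where B = "M powr p"])
    show "AE x in lebesgue_on S. norm (norm (f x) powr p) \<le> M powr p"
      using M \<open>S \<subseteq> C\<close> \<open>p > 0\<close> by (auto intro!: AE_I2 powr_mono2)
    show "(\<lambda>x. norm (f x) powr p) \<in> borel_measurable (lebesgue_on S)"
      using m by measurable
  qed
  with m show ?thesis by (simp add: Lp_on_def)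
qed

text \<open>For a test function \<open>\<phi>\<close> the product \<open>u\<^sub>i \<phi>\<close> is \<open>C\<^sup>1\<close> with compact support, so the integral of its
  partial derivative vanishes; this is the weak derivative identity. Asking \<open>u\<close> to be \<open>C\<^sup>1\<close> on the
  whole space makes \<open>u\<close> and \<open>Du\<close> bounded on the closure of the bounded set \<open>U\<close>.\<close>

lemma W1p_of_C1:
  fixes u :: "real^'n \<Rightarrow> real^'m"
  assumes U: "open U" "bounded U" and "p > 0"
    and der: "\<And>x. (u has_derivative (\<lambda>h. Du x *v h)) (at x)"
    and cont: "continuous_on UNIV Du"
  shows "W1p p U u Du"
proof -
  have contu: "continuous_on UNIV u"
    using der by (meson continuous_at_imp_continuous_on has_derivative_continuous)
  have Lp: "Lp_on p U g" if "continuous_on UNIV g" for g :: "real^'n \<Rightarrow> 'c::euclidean_space"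
    by (rule Lp_on_continuous[of _ "closure U"])
       (use U \<open>p > 0\<close> closure_subset in \<open>auto intro: continuous_on_subset[OF that] borel_open\<close>)
  have "integral\<^sup>L (lebesgue_on U) (\<lambda>x. u x $ i * frechet_derivative \<phi> (at x) (axis j 1))
      = - integral\<^sup>L (lebesgue_on U) (\<lambda>x. Du x $ i $ j * \<phi> x)"
    if \<phi>: "test_function U \<phi>" for \<phi> i j
  proof -
    note d\<phi> = test_function_deriv[OF \<phi>]
    have cont\<phi>: "continuous_on UNIV \<phi>"
      using d\<phi>(1) by (meson continuous_at_imp_continuous_on has_derivative_continuous)
    define C where "C = closure {x. \<phi> x \<noteq> 0}"
    have C: "compact C" "C \<subseteq> U" using \<phi> by (auto simp: C_def test_function_def)
    have \<phi>0: "\<phi> x = 0" if "x \<notin> C" for x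
      using that closure_subset[of "{x. \<phi> x \<noteq> 0}"] by (auto simp: C_def)
    have d\<phi>0: "frechet_derivative \<phi> (at x) h = 0" if "x \<notin> C" for x h
    proof -
      have "(\<phi> has_derivative (\<lambda>_. 0)) (at x)"
        by (rule has_derivative_transform_within_open[where f = "\<lambda>_. 0" and s = "- C"])
           (use C(1) that \<phi>0 in \<open>auto intro: compact_imp_closed\<close>)
      then show ?thesis by (simp add: frechet_derivative_at[symmetric])
    qed
    define f where "f x = u x $ i * \<phi> x" for x
    define f' where "f' x h = u x $ i * frechet_derivative \<phi> (at x) h + (Du x *v h) $ i * \<phi> x" for x h
    let ?g1 = "\<lambda>x. u x $ i * frechet_derivative \<phi> (at x) (axis j 1)"
    let ?g2 = "\<lambda>x. Du x $ i $ j * \<phi> x"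
    have f'_eq: "f' x (axis j 1) = ?g1 x + ?g2 x" for x
      by (simp add: f'_def matrix_vector_mul_component inner_axis)
    have c1: "continuous_on UNIV ?g1" by (intro continuous_intros contu d\<phi>)
    have c2: "continuous_on UNIV ?g2" by (intro continuous_intros cont cont\<phi>)
    have "(\<integral>x. f' x (axis j 1) \<partial>lborel) = 0"
    proof (rule integral_derivative_compact_support[where f = f and C = C])
      show "(f has_derivative f' x) (at x)" for x
        unfolding f_def f'_def
        by (rule has_derivative_mult[OF bounded_linear.has_derivative[OF bounded_linear_vec_nth der] d\<phi>(1)])
      show "continuous_on UNIV (\<lambda>x. f' x (axis j 1))"
        unfolding f'_eq by (intro continuous_on_add c1 c2)
    qed (use C \<phi>0 in \<open>auto simp: f_def\<close>)
    moreover have int: "integrable lborel g" if "continuous_on UNIV g" "\<And>x. x \<notin> C \<Longrightarrow> g x = 0" for g :: "real^'n \<Rightarrow> real"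
    proof -
      have "integrable lborel (\<lambda>x. indicator C x *\<^sub>R g x)"
        by (intro borel_integrable_compact C continuous_on_subset[OF that(1)]) auto
      moreover have "(\<lambda>x. indicator C x *\<^sub>R g x) = g"
        using that(2) by (auto simp: fun_eq_iff indicator_def)
      ultimately show ?thesis by simp
    qed
    have "integrable lborel ?g1" "integrable lborel ?g2"
      by (rule int[OF c1], simp add: d\<phi>0, rule int[OF c2], simp add: \<phi>0)
    ultimately have "integral\<^sup>L lborel ?g1 + integral\<^sup>L lborel ?g2 = 0"
      unfolding f'_eq by simp
    moreover have "integral\<^sup>L (lebesgue_on U) ?g1 = integral\<^sup>L lborel ?g1"
      using C d\<phi>0 by (intro integral_lebesgue_on_eq_lborel U c1) auto
    moreover have "integral\<^sup>L (lebesgue_on U) ?g2 = integral\<^sup>L lborel ?g2"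
      using C \<phi>0 by (intro integral_lebesgue_on_eq_lborel U c2) auto
    ultimately show ?thesis by linarith
  qed
  with Lp[OF contu] Lp[OF cont] show ?thesis by (simp add: W1p_def)
qed

section \<open>Winding numbers and condition INV\<close>

definition plane_of_complex :: "complex \<Rightarrow> real^2" where
  "plane_of_complex w = vector [Re w, Im w]"

lemma complex_of_plane_of_complex [simp]: "complex_of_plane (plane_of_complex w) = w"
  by (simp add: complex_of_plane_def plane_of_complex_def)

lemma plane_of_complex_of_plane [simp]: "plane_of_complex (complex_of_plane x) = x"
  by (simp add: complex_of_plane_def plane_of_complex_def vec_eq_iff forall_2)

lemma complex_of_plane_eq_iff: "complex_of_plane x = complex_of_plane y \<longleftrightarrow> x = y"
  by (metis plane_of_complex_of_plane)

lemma complex_of_plane_linear: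
  "complex_of_plane (x + y) = complex_of_plane x + complex_of_plane y"
  "complex_of_plane (x - y) = complex_of_plane x - complex_of_plane y"
  "complex_of_plane (c *\<^sub>R x) = c *\<^sub>R complex_of_plane x"
  "complex_of_plane 0 = 0"
  by (auto simp: complex_of_plane_def complex_eq_iff)

lemma norm_complex_of_plane [simp]: "norm (complex_of_plane x) = norm x"
  by (simp add: complex_of_plane_def cmod_def norm_vec_def L2_set_def sum_2)

lemma dist_complex_of_plane: "dist (complex_of_plane x) (complex_of_plane y) = dist x y"
  by (simp add: dist_norm flip: complex_of_plane_linear)

lemma bounded_linear_complex_of_plane: "bounded_linear complex_of_plane"
  by (rule bounded_linear_intro[where K = 1]) (auto simp: complex_of_plane_linear)

lemma bounded_linear_plane_of_complex: "bounded_linear plane_of_complex"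
proof (rule bounded_linear_intro[where K = 1])
  show "norm (plane_of_complex w) \<le> norm w * 1" for w
    using norm_complex_of_plane[of "plane_of_complex w"] by simp
qed (auto simp: plane_of_complex_def vec_eq_iff forall_2)

lemma complex_of_plane_expi2: "complex_of_plane (expi2 \<theta>) = cis \<theta>"
  by (simp add: complex_of_plane_def expi2_def complex_eq_iff)

lemma expi2_eq: "plane_of_complex (cis \<theta>) = expi2 \<theta>"
  using plane_of_complex_of_plane[of "expi2 \<theta>"] by (simp add: complex_of_plane_expi2)

lemma continuous_on_expi2: "continuous_on S expi2"
proof -
  have "continuous_on S (\<lambda>\<theta>. plane_of_complex (cis \<theta>))"
    by (intro bounded_linear.continuous_on[OF bounded_linear_plane_of_complex] continuous_intros)
  then show ?thesis by (simp add: expi2_eq)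
qed

lemma expi2_has_vector_derivative:
  "(expi2 has_vector_derivative plane_of_complex (\<i> * cis \<theta>)) (at \<theta> within S)"
proof -
  have "(cis has_vector_derivative \<i> * cis \<theta>) (at \<theta> within S)"
    unfolding cis_conv_exp
    by (rule has_vector_derivative_real_field) (auto intro!: derivative_eq_intros)
  from bounded_linear.has_vector_derivative[OF bounded_linear_plane_of_complex this]
  show ?thesis
    by (simp add: expi2_eq)
qed

lemma circlepath_eq:
  "circlepath (complex_of_plane x) r s = complex_of_plane (x + r *\<^sub>R expi2 (2 * pi * s))"
  unfolding circlepath complex_of_plane_linear complex_of_plane_expi2
  by (simp add: cis_conv_exp scaleR_conv_of_real mult_ac)

text \<open>The loops \<open>\<Phi> t (\<gamma> s) - \<Phi> t y\<close> form a homotopy that avoids the origin, because \<open>\<Phi> t\<close> is injective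
  and \<open>y\<close> lies off the circle \<open>\<gamma>\<close>. It joins the identity at \<open>t = a\<close> to the map \<open>u\<close> at \<open>t = b\<close>.\<close>

lemma circle_degree_isotopy:
  fixes \<Phi> :: "real \<Rightarrow> complex \<Rightarrow> complex"
  assumes "a \<le> b" "r > 0"
    and cont: "continuous_on ({a..b} \<times> UNIV) (\<lambda>p. \<Phi> (fst p) (snd p))"
    and inj: "\<And>t. t \<in> {a..b} \<Longrightarrow> inj (\<Phi> t)"
    and init: "\<And>w. \<Phi> a w = w"
    and u: "\<And>x. complex_of_plane (u x) = \<Phi> b (complex_of_plane x)"
    and y: "y \<notin> sphere x r"
  shows "circle_degree u x r (u y) = (if y \<in> ball x r then 1 else 0)"
proof -
  let ?c = "complex_of_plane x" and ?y = "complex_of_plane y"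
  define \<gamma> where "\<gamma> = circlepath ?c r"
  have y': "?y \<notin> sphere ?c r" using y by (auto simp: dist_complex_of_plane)
  have \<gamma>_sphere: "\<gamma> s \<in> sphere ?c r" if "s \<in> {0..1}" for s
    using that path_image_circlepath_nonneg[of r ?c] \<open>r > 0\<close> by (auto simp: \<gamma>_def path_image_def)
  define \<tau> where "\<tau> s = a + s * (b - a)" for s
  have \<tau>: "\<tau> s \<in> {a..b}" if "s \<in> {0..1}" for s
    using that \<open>a \<le> b\<close> mult_right_mono[of s 1 "b - a"] by (auto simp: \<tau>_def)
  define h where "h p = \<Phi> (\<tau> (fst p)) (\<gamma> (snd p)) - \<Phi> (\<tau> (fst p)) ?y" for p
  have "homotopic_loops (- {0}) (\<lambda>s. \<gamma> s - ?y) (\<lambda>s. \<Phi> b (\<gamma> s) - \<Phi> b ?y)"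
    unfolding homotopic_loops
  proof (intro exI[of _ h] conjI ballI)
    have c\<gamma>: "continuous_on ({0..1} \<times> {0..1}) (\<lambda>p::real\<times>real. \<gamma> (snd p))"
      using path_circlepath[of ?c r] unfolding path_def \<gamma>_def
      by (rule continuous_on_compose2) (auto intro!: continuous_intros)
    have "continuous_on ({0..1} \<times> {0..1}) (\<lambda>p. \<Phi> (\<tau> (fst p)) (\<gamma> (snd p)))"
      by (rule continuous_on_compose2[OF cont, of _ "\<lambda>p. (\<tau> (fst p), \<gamma> (snd p))", simplified])
         (use \<tau> in \<open>auto simp: \<tau>_def intro!: continuous_intros c\<gamma>\<close>)
    moreover have "continuous_on ({0..1} \<times> {0..1}) (\<lambda>p::real\<times>real. \<Phi> (\<tau> (fst p)) ?y)"
      by (rule continuous_on_compose2[OF cont, of _ "\<lambda>p. (\<tau> (fst p), ?y)", simplified])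
         (use \<tau> in \<open>auto simp: \<tau>_def intro!: continuous_intros\<close>)
    ultimately show "continuous_on ({0..1} \<times> {0..1}) h"
      unfolding h_def by (intro continuous_on_diff)
    have "h (s, s') \<noteq> 0" if "s \<in> {0..1}" "s' \<in> {0..1}" for s s'
      using injD[OF inj[OF \<tau>[OF that(1)]], of "\<gamma> s'" ?y] \<gamma>_sphere[OF that(2)] y' by (auto simp: h_def)
    then show "h \<in> {0..1} \<times> {0..1} \<rightarrow> - {0}" by auto
  qed (auto simp: h_def \<tau>_def init pathstart_def pathfinish_def \<gamma>_def circlepath)
  then have "winding_number (\<lambda>s. \<Phi> b (\<gamma> s) - \<Phi> b ?y) 0 = winding_number (\<lambda>s. \<gamma> s - ?y) 0"
    by (rule winding_number_homotopic_loops[symmetric])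
  then have "winding_number (\<lambda>s. \<Phi> b (\<gamma> s)) (\<Phi> b ?y) = winding_number \<gamma> ?y"
    by (simp flip: winding_number_offset)
  moreover have "circle_degree u x r (u y) = winding_number (\<lambda>s. \<Phi> b (\<gamma> s)) (\<Phi> b ?y)"
    unfolding circle_degree_def u \<gamma>_def circlepath_eq ..
  moreover have "winding_number \<gamma> ?y = (if y \<in> ball x r then 1 else 0)"
  proof (cases "y \<in> ball x r")
    case True
    then show ?thesis
      unfolding \<gamma>_def using winding_number_circlepath[of ?y ?c r]
      by (simp add: dist_complex_of_plane dist_commute flip: dist_norm)
  next
    case False
    have "winding_number \<gamma> ?y = 0"
      unfolding \<gamma>_def
      by (rule winding_number_zero_outside[of _ "cball ?c r"])
         (use False y \<open>r > 0\<close> path_image_circlepath_nonneg[of r ?c] in \<open>auto simp: dist_complex_of_plane\<close>)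
    with False show ?thesis by simp
  qed
  ultimately show ?thesis by simp
qed

lemma Lp_on_circle:
  assumes "continuous_on UNIV g" "p > 0"
  shows "Lp_on p {0..2*pi} (\<lambda>\<theta>. g (c + \<rho> *\<^sub>R expi2 \<theta>) :: 'a::euclidean_space)"
  by (rule Lp_on_continuous[of _ "{0..2*pi}"])
     (use assms in \<open>auto intro!: continuous_on_compose2[OF assms(1)] continuous_intros continuous_on_expi2\<close>)

text \<open>The constant sequence \<open>u\<close> is an admissible approximation in the definition of the trace.\<close>

lemma circle_trace_continuous:
  assumes "W1p p U u Du" "continuous_on UNIV u" "p > 0"
  shows "circle_trace p U u Du c \<rho> u"
  unfolding circle_trace_def
  using assms Lp_on_circle[OF assms(2,3)] continuous_on_subset[OF assms(2)]
  by (intro conjI exI[of _ "\<lambda>_. u"] exI[of _ "\<lambda>_. Du"]) auto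

lemma W1p_circle_rep_of_C1:
  fixes u :: "real^2 \<Rightarrow> real^2"
  assumes "p > 0"
    and der: "\<And>x. (u has_derivative (\<lambda>h. Du x *v h)) (at x)"
    and cont: "continuous_on UNIV Du"
  shows "W1p_circle_rep p u x r u"
proof -
  have contu: "continuous_on UNIV u"
    using der by (meson continuous_at_imp_continuous_on has_derivative_continuous)
  define h where "h \<theta> = Du (x + r *\<^sub>R expi2 \<theta>) *v (r *\<^sub>R plane_of_complex (\<i> * cis \<theta>))" for \<theta>
  have "continuous_on UNIV (\<lambda>\<theta>. Du (x + r *\<^sub>R expi2 \<theta>))"
    by (rule continuous_on_compose2[OF cont]) (auto intro!: continuous_intros continuous_on_expi2)
  then have "continuous_on UNIV h"
    unfolding h_def matrix_vector_mult_def
    by (intro continuous_on_vec_lambda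
        continuous_intros bounded_linear.continuous_on[OF bounded_linear_plane_of_complex])
  then have "Lp_on p {0..2*pi} h"
    using \<open>p > 0\<close> by (intro Lp_on_continuous[of _ "{0..2*pi}"]) (auto intro: continuous_on_subset)
  moreover have "(h has_integral (u (x + r *\<^sub>R expi2 \<theta>) - u (x + r *\<^sub>R expi2 0))) {0..\<theta>}" if "\<theta> \<in> {0..2*pi}" for \<theta>
  proof (rule fundamental_theorem_of_calculus)
    fix s
    have "((\<lambda>s. x + r *\<^sub>R expi2 s) has_vector_derivative r *\<^sub>R plane_of_complex (\<i> * cis s)) (at s within {0..\<theta>})"
      by (auto intro!: derivative_eq_intros expi2_has_vector_derivative)
    from vector_derivative_diff_chain_within[OF this has_derivative_at_withinI[OF der]]
    show "((\<lambda>s. u (x + r *\<^sub>R expi2 s)) has_vector_derivative h s) (at s within {0..\<theta>})"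
      by (simp add: h_def o_def)
  qed (use that in auto)
  ultimately show ?thesis
    using contu by (auto simp: W1p_circle_rep_def intro: continuous_on_subset)
qed

text \<open>All admissible radii are good, and the inclusions hold at every point: off the circle by
  \<open>circle_degree_isotopy\<close>, while points of the circle are mapped into the image of the circle, which
  is disjoint from the topological image by definition.\<close>

lemma INV_of_isotopy:
  fixes u :: "real^2 \<Rightarrow> real^2" and \<Phi> :: "real \<Rightarrow> complex \<Rightarrow> complex"
  assumes "a \<le> b" "p > 0"
    and cont: "continuous_on ({a..b} \<times> UNIV) (\<lambda>p. \<Phi> (fst p) (snd p))"
    and inj: "\<And>t. t \<in> {a..b} \<Longrightarrow> inj (\<Phi> t)"
    and init: "\<And>w. \<Phi> a w = w"
    and u: "\<And>x. complex_of_plane (u x) = \<Phi> b (complex_of_plane x)"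
    and der: "\<And>x. (u has_derivative (\<lambda>h. Du x *v h)) (at x)"
    and contD: "continuous_on UNIV Du"
  shows "INV p B E u"
  unfolding INV_def
proof (intro ballI exI[of _ "radii B E _"] conjI exI[of _ u])
  fix x r assume r: "r \<in> radii B E x"
  then have "r > 0" by (simp add: radii_def)
  have degree: "circle_degree u x r (u y) = (if y \<in> ball x r then 1 else 0)" if "y \<notin> sphere x r" for y
    using inj by (rule circle_degree_isotopy[OF \<open>a \<le> b\<close> \<open>r > 0\<close> cont _ init u that])
  show "W1p_circle_rep p u x r u" by (rule W1p_circle_rep_of_C1[OF \<open>p > 0\<close> der contD])
  have "inj u"
  proof (rule injI)
    fix x y assume "u x = u y"
    then have "\<Phi> b (complex_of_plane x) = \<Phi> b (complex_of_plane y)" by (simp flip: u)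
    then have "complex_of_plane x = complex_of_plane y"
      using injD[OF inj[of b]] \<open>a \<le> b\<close> by (meson atLeastAtMost_iff order_refl)
    then show "x = y" by (simp only: complex_of_plane_eq_iff)
  qed
  have im_T: "u y \<in> im_T u x r \<longleftrightarrow> y \<in> ball x r" for y
  proof (cases "y \<in> sphere x r")
    case True
    then show ?thesis by (auto simp: im_T_def)
  next
    case False
    then have "u y \<notin> u ` sphere x r" using injD[OF \<open>inj u\<close>] by blast
    then show ?thesis using degree[OF False] by (simp add: im_T_def)
  qed
  show "AE y in lebesgue_on (ball x r \<inter> E). u y \<in> im_T u x r"
    unfolding im_T by (rule AE_I2) simp
  show "AE y in lebesgue_on (E - ball x r). u y \<notin> im_T u x r"
    unfolding im_T by (rule AE_I2) simp
qed auto

section \<open>Cutoffs and divergence-free blocks\<close>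

text \<open>The building block of a cutoff of class \<open>C\<^sup>2\<close> given by a formula.\<close>

lemma DERIV_max0_power:
  fixes s :: real
  shows "((\<lambda>s. (max 0 s) ^ (n + 2)) has_real_derivative real (n + 2) * (max 0 s) ^ (n + 1)) (at s)"
proof (cases "s = 0")
  case False
  show ?thesis
  proof (cases "s > 0")
    case True
    have "((\<lambda>s. s ^ (n + 2)) has_real_derivative real (n + 2) * s ^ (n + 1)) (at s)"
      using DERIV_pow[of "n + 2" s UNIV] by simp
    then have "((\<lambda>s. (max 0 s) ^ (n + 2)) has_real_derivative real (n + 2) * s ^ (n + 1)) (at s)"
      by (rule has_field_derivative_transform_within_open[of _ _ _ "{0<..}"]) (use True in auto)
    then show ?thesis using True by simp
  next
    case neg: False
    have "((\<lambda>s. 0) has_real_derivative 0) (at s)" by simp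
    then have "((\<lambda>s. (max 0 s) ^ (n + 2)) has_real_derivative 0) (at s)"
      by (rule has_field_derivative_transform_within_open[of _ _ _ "{..<0}"]) (use neg False in auto)
    then show ?thesis using neg by simp
  qed
next
  case True
  have "((\<lambda>h::real. (max 0 h) ^ (n + 2) / h) \<longlongrightarrow> 0) (at 0)"
  proof (rule Lim_null_comparison)
    show "\<forall>\<^sub>F h in at 0. norm ((max 0 h) ^ (n + 2) / h) \<le> (max 0 h) ^ (n + 1)" for h :: real
      by (auto simp: eventually_at_filter max_def)
    have "isCont (\<lambda>h::real. (max 0 h) ^ (n + 1)) 0" by (intro continuous_intros)
    then show "((\<lambda>h::real. (max 0 h) ^ (n + 1)) \<longlongrightarrow> 0) (at 0)" by (simp add: isCont_def)
  qed
  then show ?thesis using True by (simp add: has_field_derivative_iff)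
qed

text \<open>Equal to 1 on the negative half line and to 0 from 1 on. Two continuous derivatives are needed,
  since the velocity contains \<open>cutoff'\<close> and has to be \<open>C\<^sup>1\<close>.\<close>

definition cutoff :: "real \<Rightarrow> real" where
  "cutoff s = (max 0 (1 - (max 0 s) ^ 3)) ^ 3"

definition cutoff' :: "real \<Rightarrow> real" where
  "cutoff' s = - 9 * ((max 0 (1 - (max 0 s) ^ 3))\<^sup>2 * (max 0 s)\<^sup>2)"

definition cutoff'' :: "real \<Rightarrow> real" where
  "cutoff'' s = - 9 * ((max 0 (1 - (max 0 s) ^ 3))\<^sup>2 * (2 * max 0 s)
     - 6 * max 0 (1 - (max 0 s) ^ 3) * (max 0 s) ^ 4)"

lemma DERIV_cutoff: "(cutoff has_real_derivative cutoff' s) (at s)"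
  and DERIV_cutoff': "(cutoff' has_real_derivative cutoff'' s) (at s)"
proof -
  have d3: "((\<lambda>s. (max 0 s) ^ 3) has_real_derivative 3 * (max 0 s)\<^sup>2) (at s)" for s :: real
    using DERIV_max0_power[of 1 s] by (simp add: numeral_eq_Suc)
  have d2: "((\<lambda>s. (max 0 s)\<^sup>2) has_real_derivative 2 * max 0 s) (at s)" for s :: real
    using DERIV_max0_power[of 0 s] by (simp add: numeral_eq_Suc)
  have i: "((\<lambda>s. 1 - (max 0 s) ^ 3) has_real_derivative - (3 * (max 0 s)\<^sup>2)) (at s)"
    using DERIV_diff[OF DERIV_const d3] by simp
  show "(cutoff has_real_derivative cutoff' s) (at s)"
    unfolding cutoff_def[abs_def]
    by (rule DERIV_cong[OF DERIV_chain2[OF d3 i]]) (simp add: cutoff'_def)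
  show "(cutoff' has_real_derivative cutoff'' s) (at s)"
    unfolding cutoff'_def[abs_def]
    by (rule DERIV_cong[OF DERIV_cmult[OF DERIV_mult[OF DERIV_chain2[OF d2 i] d2]]])
       (simp add: cutoff''_def algebra_simps numeral_eq_Suc)
qed

lemma continuous_on_cutoff [continuous_intros]:
  assumes "continuous_on S f"
  shows "continuous_on S (\<lambda>x. cutoff (f x))" "continuous_on S (\<lambda>x. cutoff' (f x))"
    "continuous_on S (\<lambda>x. cutoff'' (f x))"
  unfolding cutoff_def cutoff'_def cutoff''_def by (intro continuous_intros assms)+

lemma cutoff_le0: "s \<le> 0 \<Longrightarrow> cutoff s = 1" "s \<le> 0 \<Longrightarrow> cutoff' s = 0"
  by (auto simp: cutoff_def cutoff'_def)

lemma cutoff_ge1: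
  assumes "s \<ge> 1" shows "cutoff s = 0" "cutoff' s = 0"
proof -
  have "(max 0 s) ^ 3 \<ge> 1" using assms by simp
  then show "cutoff s = 0" "cutoff' s = 0" by (auto simp: cutoff_def cutoff'_def)
qed

text \<open>Continuously differentiable in space, with value and spatial derivative jointly continuous in
  time and space: the regularity that the flow needs. In time the data are only continuous.\<close>

definition C1x_on :: "(real \<times> complex) set \<Rightarrow> (real \<Rightarrow> complex \<Rightarrow> complex) \<Rightarrow> bool" where
  "C1x_on W V \<longleftrightarrow> (\<forall>p\<in>W. V (fst p) differentiable at (snd p)) \<and>
     continuous_on W (\<lambda>p. V (fst p) (snd p)) \<and>
     (\<forall>h. continuous_on W (\<lambda>p. frechet_derivative (V (fst p)) (at (snd p)) h))"

lemma C1x_onI: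
  assumes der: "\<And>t w. (t, w) \<in> W \<Longrightarrow> (V t has_derivative D t w) (at w)"
    and "continuous_on W (\<lambda>p. V (fst p) (snd p))"
    and "\<And>h. continuous_on W (\<lambda>p. D (fst p) (snd p) h)"
  shows "C1x_on W V"
proof -
  have "frechet_derivative (V (fst p)) (at (snd p)) = D (fst p) (snd p)" if "p \<in> W" for p
    using that frechet_derivative_at[OF der[of "fst p" "snd p"]] by simp
  with assms show ?thesis
    by (force simp: C1x_on_def differentiable_def cong: continuous_on_cong)
qed

lemma C1x_onD:
  assumes "C1x_on W V"
  shows "(t, w) \<in> W \<Longrightarrow> (V t has_derivative frechet_derivative (V t) (at w)) (at w)"
    and "continuous_on W (\<lambda>p. V (fst p) (snd p))"
    and "continuous_on W (\<lambda>p. frechet_derivative (V (fst p)) (at (snd p)) h)"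
  using assms by (auto simp: C1x_on_def frechet_derivative_works)

lemma C1x_on_add:
  assumes "C1x_on W V1" "C1x_on W V2"
  shows "C1x_on W (\<lambda>t w. V1 t w + V2 t w)"
  by (rule C1x_onI[where D = "\<lambda>t w h. frechet_derivative (V1 t) (at w) h + frechet_derivative (V2 t) (at w) h"])
     (use C1x_onD[OF assms(1)] C1x_onD[OF assms(2)] in \<open>auto intro!: has_derivative_add continuous_intros\<close>)

lemma C1x_on_sum:
  assumes "finite I" "\<And>i. i \<in> I \<Longrightarrow> C1x_on W (V i)"
  shows "C1x_on W (\<lambda>t w. \<Sum>i\<in>I. V i t w)"
  using assms
proof (induction I)
  case empty
  show ?case
    by (rule C1x_onI[where D = "\<lambda>_ _ _. 0"]) auto
next
  case (insert i I)
  then show ?case by (simp add: C1x_on_add)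
qed

text \<open>How a cutoff extends a local formula by zero: the region \<open>\<alpha> < 2\<close>, where the formula is regular, and
  the region \<open>\<alpha> > 1\<close>, where the cutoff vanishes, are relatively open and overlap. Outside the region
  \<open>\<alpha> < 2\<close> the local formula may be meaningless, e.g. use a branch cut of the logarithm.\<close>

lemma C1x_on_cutoff_region:
  fixes \<alpha> :: "real \<Rightarrow> complex \<Rightarrow> real"
  assumes cont: "continuous_on (T \<times> UNIV) (\<lambda>p. \<alpha> (fst p) (snd p))"
    and V: "C1x_on {p \<in> T \<times> UNIV. \<alpha> (fst p) (snd p) < 2} V"
    and zero: "\<And>t w. t \<in> T \<Longrightarrow> \<alpha> t w > 1 \<Longrightarrow> V t w = 0"
  shows "C1x_on (T \<times> UNIV) V"
proof -
  let ?S = "T \<times> (UNIV :: complex set)"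
  let ?W = "{p \<in> ?S. \<alpha> (fst p) (snd p) < 2}" and ?N = "{p \<in> ?S. \<alpha> (fst p) (snd p) > 1}"
  have slice: "continuous_on UNIV (\<alpha> t)" if "t \<in> T" for t
  proof -
    have "continuous_on UNIV (\<lambda>w. \<alpha> (fst (t, w)) (snd (t, w)))"
      by (rule continuous_on_compose2[OF cont]) (use that in \<open>auto intro!: continuous_intros\<close>)
    then show ?thesis by simp
  qed
  have derN: "(V t has_derivative (\<lambda>_. 0)) (at w)" if "t \<in> T" "\<alpha> t w > 1" for t w
  proof (rule has_derivative_transform_within_open[where f = "\<lambda>_. 0" and s = "{w. \<alpha> t w > 1}"])
    show "open {w. \<alpha> t w > 1}"
      using slice[OF that(1)] by (intro open_Collect_less) (auto intro!: continuous_intros)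
  qed (use that zero in auto)
  have N: "C1x_on ?N V"
    by (rule C1x_onI[where D = "\<lambda>_ _ _. 0"])
       (use derN zero in \<open>auto intro: continuous_on_eq[OF continuous_on_const[of _ 0]]\<close>)
  have "openin (top_of_set ?S) (?S \<inter> (\<lambda>p. \<alpha> (fst p) (snd p)) -` {..<2})"
    "openin (top_of_set ?S) (?S \<inter> (\<lambda>p. \<alpha> (fst p) (snd p)) -` {1<..})"
    using cont by (intro continuous_openin_preimage_gen; simp)+
  moreover have "?S \<inter> (\<lambda>p. \<alpha> (fst p) (snd p)) -` {..<2} = ?W" "?S \<inter> (\<lambda>p. \<alpha> (fst p) (snd p)) -` {1<..} = ?N"
    by auto
  ultimately obtain O1 O2 where O: "open O1" "open O2" "?W = ?S \<inter> O1" "?N = ?S \<inter> O2"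
    unfolding openin_open by auto
  have cov: "?S \<subseteq> O1 \<union> O2"
  proof
    fix p assume "p \<in> ?S"
    then have "p \<in> ?W \<or> p \<in> ?N" by auto
    then show "p \<in> O1 \<union> O2" using O by blast
  qed
  have glue: "continuous_on ?S g" if "continuous_on ?W g" "continuous_on ?N g" for g :: "real \<times> complex \<Rightarrow> complex"
    unfolding continuous_on_eq_continuous_within
  proof
    fix p assume p: "p \<in> ?S"
    have *: "continuous (at p within ?S) g" if "open O'" "p \<in> O'" "continuous_on (?S \<inter> O') g" for O'
    proof -
      have "at p within ?S = at p within (?S \<inter> O')"
        by (rule at_within_nhd[of p O']) (use that in auto)
      moreover have "continuous (at p within (?S \<inter> O')) g"
        using that p by (simp add: continuous_on_eq_continuous_within)
      ultimately show ?thesis by simp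
    qed
    show "continuous (at p within ?S) g"
      using cov p *[of O1] *[of O2] O that by auto
  qed
  show ?thesis
    unfolding C1x_on_def
  proof (intro conjI allI ballI glue)
    fix p assume "p \<in> ?S"
    then have "p \<in> ?W \<or> p \<in> ?N" by auto
    then show "V (fst p) differentiable at (snd p)"
      using V N by (auto simp: C1x_on_def)
  qed (use V N in \<open>auto simp: C1x_on_def\<close>)
qed

text \<open>The trace of a real linear map of the plane, so that \<open>plane_div\<close> of the derivative of a field is
  its divergence.\<close>

definition plane_div :: "(complex \<Rightarrow> complex) \<Rightarrow> real" where
  "plane_div A = Re (A 1) + Im (A \<i>)"

text \<open>For \<open>F\<close> holomorphic, \<open>cnj F'\<close> is a divergence-free field with stream function \<open>Im F\<close>. With
  \<open>\<chi> w = cutoff (\<kappa> (\<bar>w - z\<bar>\<^sup>2 - \<rho>))\<close> the block is the field \<open>- \<i> \<nabla>(\<chi> Im F)\<close> with stream function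
  \<open>\<chi> Im F\<close>. It is \<open>cnj F'\<close> on the circle \<open>\<bar>w - z\<bar>\<^sup>2 = \<rho>\<close>, where \<open>\<chi> = 1\<close> and \<open>\<chi>' = 0\<close>, and it is zero
  away from it, outside for \<open>\<kappa> > 0\<close> and inside for \<open>\<kappa> < 0\<close>.\<close>

definition stream_block ::
    "real \<Rightarrow> real \<Rightarrow> complex \<Rightarrow> (complex \<Rightarrow> complex) \<Rightarrow> (complex \<Rightarrow> complex) \<Rightarrow> complex \<Rightarrow> complex" where
  "stream_block \<kappa> \<rho> z F F1 w =
     cutoff (\<kappa> * ((w - z) \<bullet> (w - z) - \<rho>)) *\<^sub>R cnj (F1 w)
     - (2 * \<kappa> * cutoff' (\<kappa> * ((w - z) \<bullet> (w - z) - \<rho>)) * Im (F w)) *\<^sub>R (\<i> * (w - z))"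

definition stream_block_deriv ::
    "real \<Rightarrow> real \<Rightarrow> complex \<Rightarrow> (complex \<Rightarrow> complex) \<Rightarrow> (complex \<Rightarrow> complex) \<Rightarrow> (complex \<Rightarrow> complex) \<Rightarrow>
     complex \<Rightarrow> complex \<Rightarrow> complex" where
  "stream_block_deriv \<kappa> \<rho> z F F1 F2 w h =
     (let s = \<kappa> * ((w - z) \<bullet> (w - z) - \<rho>); s' = 2 * \<kappa> * ((w - z) \<bullet> h) in
       (cutoff' s * s') *\<^sub>R cnj (F1 w) + cutoff s *\<^sub>R cnj (F2 w * h)
       - (2 * \<kappa>) *\<^sub>R ((cutoff'' s * s' * Im (F w) + cutoff' s * Im (F1 w * h)) *\<^sub>R (\<i> * (w - z))
            + (cutoff' s * Im (F w)) *\<^sub>R (\<i> * h)))"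

lemma has_derivative_cutoff:
  assumes "(g has_derivative g') (at w)"
  shows "((\<lambda>w. cutoff (g w)) has_derivative (\<lambda>h. cutoff' (g w) * g' h)) (at w)"
    and "((\<lambda>w. cutoff' (g w)) has_derivative (\<lambda>h. cutoff'' (g w) * g' h)) (at w)"
  using has_derivative_compose[OF assms] DERIV_cutoff DERIV_cutoff'
  unfolding has_field_derivative_def by blast+

lemma stream_block_has_derivative:
  assumes F: "(F has_field_derivative F1 w) (at w)" "(F1 has_field_derivative F2 w) (at w)"
  shows "(stream_block \<kappa> \<rho> z F F1 has_derivative stream_block_deriv \<kappa> \<rho> z F F1 F2 w) (at w)"
proof -
  have s: "((\<lambda>w. \<kappa> * ((w - z) \<bullet> (w - z) - \<rho>)) has_derivative (\<lambda>h. 2 * \<kappa> * ((w - z) \<bullet> h))) (at w)"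
    by (auto intro!: derivative_eq_intros simp: inner_commute algebra_simps)
  have F0': "(F has_derivative (\<lambda>h. F1 w * h)) (at w)" and F1': "(F1 has_derivative (\<lambda>h. F2 w * h)) (at w)"
    using F by (auto simp: has_field_derivative_def)
  note I = bounded_linear.has_derivative[OF bounded_linear_Im F0']
    and C = bounded_linear.has_derivative[OF bounded_linear_cnj F1']
  have r: "((\<lambda>w. \<i> * (w - z)) has_derivative (\<lambda>h. \<i> * h)) (at w)"
    by (auto intro!: derivative_eq_intros)
  note A = has_derivative_scaleR[OF has_derivative_cutoff(1)[OF s] C]
    and B = has_derivative_scaleR[OF has_derivative_mult[OF
        has_derivative_mult[OF has_derivative_const[of "2 * \<kappa>"] has_derivative_cutoff(2)[OF s]] I] r]
  show ?thesis
    unfolding stream_block_def[abs_def]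
    by (rule has_derivative_eq_rhs[OF has_derivative_diff[OF A B]])
       (simp add: stream_block_deriv_def Let_def fun_eq_iff scaleR_add_left scaleR_diff_right scaleR_add_right mult_ac)
qed

text \<open>The two contributions of \<open>cutoff'\<close> to the divergence cancel; all other terms are separately
  trace free.\<close>

lemma plane_div_stream_block: "plane_div (stream_block_deriv \<kappa> \<rho> z F F1 F2 w) = 0"
  by (simp add: plane_div_def stream_block_deriv_def Let_def inner_complex_def algebra_simps)

lemma plane_div_simps:
  "plane_div (\<lambda>h. A h + B h) = plane_div A + plane_div B"
  "plane_div (\<lambda>h. 0) = 0"
  "finite I \<Longrightarrow> plane_div (\<lambda>h. \<Sum>i\<in>I. C i h) = (\<Sum>i\<in>I. plane_div (C i))"
  by (auto simp: plane_div_def sum.distrib)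

lemma plane_div_cnj: "plane_div (\<lambda>h. cnj (A * h)) = 0"
  by (simp add: plane_div_def)

lemma continuous_on_fst_compose:
  "continuous_on T f \<Longrightarrow> fst ` W \<subseteq> T \<Longrightarrow> continuous_on W (\<lambda>p. f (fst p))"
  by (rule continuous_on_compose2[of T f]) (auto intro!: continuous_intros)

lemma frechet_derivative_locally_zero:
  fixes V :: "complex \<Rightarrow> complex"
  assumes "continuous_on UNIV \<alpha>" "\<And>w. \<alpha> w > (1::real) \<Longrightarrow> V w = 0" "\<alpha> w > 1"
  shows "(V has_derivative (\<lambda>_. 0)) (at w)" "frechet_derivative V (at w) = (\<lambda>_. 0)"
proof -
  show "(V has_derivative (\<lambda>_. 0)) (at w)"
  proof (rule has_derivative_transform_within_open[where f = "\<lambda>_. 0" and s = "{w. \<alpha> w > 1}"])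
    show "open {w. \<alpha> w > 1}"
      using assms(1) by (intro open_Collect_less) (auto intro!: continuous_intros)
  qed (use assms in auto)
  then show "frechet_derivative V (at w) = (\<lambda>_. 0)" by (simp add: frechet_derivative_at[symmetric])
qed

lemma stream_block_zero: "\<kappa> * ((w - z) \<bullet> (w - z) - \<rho>) \<ge> 1 \<Longrightarrow> stream_block \<kappa> \<rho> z F F1 w = 0"
  by (simp add: stream_block_def cutoff_ge1)

lemma stream_block_on_circle:
  "(w - z) \<bullet> (w - z) = \<rho> \<Longrightarrow> stream_block \<kappa> \<rho> z F F1 w = cnj (F1 w)"
  by (simp add: stream_block_def cutoff_le0)

lemma
  fixes F F1 F2 :: "real \<Rightarrow> complex \<Rightarrow> complex"
  assumes cont: "continuous_on T \<rho>" "continuous_on T z"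
    and W: "W = {p \<in> T \<times> UNIV. \<kappa> * ((snd p - z (fst p)) \<bullet> (snd p - z (fst p)) - \<rho> (fst p)) < 2}"
    and F: "\<And>t w. (t, w) \<in> W \<Longrightarrow> (F t has_field_derivative F1 t w) (at w)"
      "\<And>t w. (t, w) \<in> W \<Longrightarrow> (F1 t has_field_derivative F2 t w) (at w)"
    and contF: "continuous_on W (\<lambda>p. F (fst p) (snd p))" "continuous_on W (\<lambda>p. F1 (fst p) (snd p))"
      "continuous_on W (\<lambda>p. F2 (fst p) (snd p))"
  shows C1x_on_stream_block: "C1x_on (T \<times> UNIV) (\<lambda>t. stream_block \<kappa> (\<rho> t) (z t) (F t) (F1 t))"
    and plane_div_frechet_stream_block: "t \<in> T \<Longrightarrow>
      plane_div (frechet_derivative (stream_block \<kappa> (\<rho> t) (z t) (F t) (F1 t)) (at w)) = 0"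
proof -
  have TW: "fst ` W \<subseteq> T" unfolding W by auto
  note c = continuous_on_fst_compose[OF cont(1) TW] continuous_on_fst_compose[OF cont(2) TW]
  have D: "(stream_block \<kappa> \<rho>' z' (F t) (F1 t) has_derivative stream_block_deriv \<kappa> \<rho>' z' (F t) (F1 t) (F2 t) w) (at w)"
    if "(t, w) \<in> W" for t w \<rho>' z'
    using that by (intro stream_block_has_derivative F)
  have 1: "C1x_on W (\<lambda>t. stream_block \<kappa> (\<rho> t) (z t) (F t) (F1 t))"
  proof (rule C1x_onI[OF D])
    show "continuous_on W (\<lambda>p. stream_block \<kappa> (\<rho> (fst p)) (z (fst p)) (F (fst p)) (F1 (fst p)) (snd p))"
      unfolding stream_block_def by (intro continuous_intros c contF)
    show "continuous_on W (\<lambda>p. stream_block_deriv \<kappa> (\<rho> (fst p)) (z (fst p)) (F (fst p)) (F1 (fst p)) (F2 (fst p)) (snd p) h)" for h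
      unfolding stream_block_deriv_def Let_def by (intro continuous_intros c contF)
  qed
  have c': "continuous_on (T \<times> UNIV) (\<lambda>p. \<rho> (fst p))" "continuous_on (T \<times> UNIV) (\<lambda>p. z (fst p))"
    by (rule continuous_on_fst_compose[OF cont(1)], force, rule continuous_on_fst_compose[OF cont(2)], force)
  show "C1x_on (T \<times> UNIV) (\<lambda>t. stream_block \<kappa> (\<rho> t) (z t) (F t) (F1 t))"
    by (rule C1x_on_cutoff_region[where \<alpha> = "\<lambda>t w. \<kappa> * ((w - z t) \<bullet> (w - z t) - \<rho> t)"])
       (use 1 W in \<open>auto intro!: continuous_intros c' stream_block_zero\<close>)
  show "plane_div (frechet_derivative (stream_block \<kappa> (\<rho> t) (z t) (F t) (F1 t)) (at w)) = 0" if "t \<in> T"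
  proof (cases "(t, w) \<in> W")
    case True
    then show ?thesis
      by (simp add: frechet_derivative_at[OF D[OF True], symmetric] plane_div_stream_block)
  next
    case False
    then have "frechet_derivative (stream_block \<kappa> (\<rho> t) (z t) (F t) (F1 t)) (at w) = (\<lambda>_. 0)"
      by (intro frechet_derivative_locally_zero(2)[where \<alpha> = "\<lambda>w. \<kappa> * ((w - z t) \<bullet> (w - z t) - \<rho> t)"])
         (use that W in \<open>auto intro!: continuous_intros stream_block_zero\<close>)
    then show ?thesis by (simp add: plane_div_simps)
  qed
qed

text \<open>The field \<open>c (w - z) / \<bar>w - z\<bar>\<^sup>2\<close>, written as \<open>cnj (c / (w - z))\<close>, with the singularity cut out: the factor
  is 0 for \<open>\<bar>w - z\<bar>\<^sup>2 \<le> R\<^sup>2 / 2\<close> and 1 for \<open>\<bar>w - z\<bar> \<ge> R\<close>.\<close>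

definition point_source :: "real \<Rightarrow> complex \<Rightarrow> real \<Rightarrow> complex \<Rightarrow> complex" where
  "point_source R z c w = (1 - cutoff (2 / R\<^sup>2 * ((w - z) \<bullet> (w - z)) - 1)) *\<^sub>R cnj (of_real c / (w - z))"

definition point_source_deriv :: "real \<Rightarrow> complex \<Rightarrow> real \<Rightarrow> complex \<Rightarrow> complex \<Rightarrow> complex" where
  "point_source_deriv R z c w h =
     (let s = 2 / R\<^sup>2 * ((w - z) \<bullet> (w - z)) - 1 in
      - (cutoff' s * (2 / R\<^sup>2 * (2 * ((w - z) \<bullet> h)))) *\<^sub>R cnj (of_real c / (w - z))
      + (1 - cutoff s) *\<^sub>R cnj (- (of_real c / (w - z)\<^sup>2) * h))"

lemma point_source_has_derivative:
  assumes "w \<noteq> z"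
  shows "(point_source R z c has_derivative point_source_deriv R z c w) (at w)"
proof -
  have s: "((\<lambda>w. k * ((w - z) \<bullet> (w - z)) - 1) has_derivative (\<lambda>h. k * (2 * ((w - z) \<bullet> h)))) (at w)" for k
    by (auto intro!: derivative_eq_intros simp: inner_commute algebra_simps)
  have "((\<lambda>w. of_real c / (w - z)) has_field_derivative - (of_real c / (w - z)\<^sup>2)) (at w)"
    using assms by (auto intro!: derivative_eq_intros simp: power2_eq_square)
  then have "((\<lambda>w. of_real c / (w - z)) has_derivative (\<lambda>h. - (of_real c / (w - z)\<^sup>2) * h)) (at w)"
    unfolding has_field_derivative_def .
  note C = bounded_linear.has_derivative[OF bounded_linear_cnj this]
  show ?thesis
    unfolding point_source_def[abs_def]
    by (rule has_derivative_eq_rhs[OF has_derivative_scaleR[OF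
          has_derivative_diff[OF has_derivative_const has_derivative_cutoff(1)[OF s]] C]])
       (simp add: point_source_deriv_def Let_def fun_eq_iff)
qed

lemma point_source_outside:
  assumes "R > 0" "norm (w - z) \<ge> R"
  shows "point_source R z c w = cnj (of_real c / (w - z))"
    and "plane_div (frechet_derivative (point_source R z c) (at w)) = 0"
proof -
  have "R\<^sup>2 \<le> (w - z) \<bullet> (w - z)"
    using assms by (simp flip: power2_norm_eq_inner)
  then have s: "2 / R\<^sup>2 * ((w - z) \<bullet> (w - z)) - 1 \<ge> 1"
    using assms(1) by (simp add: field_simps)
  then show "point_source R z c w = cnj (of_real c / (w - z))"
    by (simp add: point_source_def cutoff_ge1)
  have "w \<noteq> z" using assms by auto
  from frechet_derivative_at[OF point_source_has_derivative[OF this, of R c]]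
  have "frechet_derivative (point_source R z c) (at w) = point_source_deriv R z c w" ..
  also have "\<dots> = (\<lambda>h. cnj (- (of_real c / (w - z)\<^sup>2) * h))"
    using s by (simp only: point_source_deriv_def Let_def cutoff_ge1 fun_eq_iff) simp
  finally show "plane_div (frechet_derivative (point_source R z c) (at w)) = 0"
    by (simp only: plane_div_cnj)
qed

lemma C1x_on_point_source:
  assumes "R > 0" "continuous_on T z" "continuous_on T c"
  shows "C1x_on (T \<times> UNIV) (\<lambda>t. point_source R (z t) (c t))"
proof (rule C1x_on_cutoff_region[where \<alpha> = "\<lambda>t w. 2 - 2 / R\<^sup>2 * ((w - z t) \<bullet> (w - z t))"])
  have c': "continuous_on (T \<times> UNIV) (\<lambda>p. z (fst p))"
    by (rule continuous_on_fst_compose[OF assms(2)]) force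
  then show "continuous_on (T \<times> UNIV) (\<lambda>p. 2 - 2 / R\<^sup>2 * ((snd p - z (fst p)) \<bullet> (snd p - z (fst p))))"
    by (intro continuous_intros)
  let ?W = "{p \<in> T \<times> UNIV. 2 - 2 / R\<^sup>2 * ((snd p - z (fst p)) \<bullet> (snd p - z (fst p))) < 2}"
  have ne: "\<forall>p\<in>?W. snd p - z (fst p) \<noteq> 0" and ne2: "\<forall>p\<in>?W. (snd p - z (fst p))\<^sup>2 \<noteq> 0"
    by force+
  have TW: "fst ` ?W \<subseteq> T" by auto
  note c = continuous_on_fst_compose[OF assms(2) TW] continuous_on_fst_compose[OF assms(3) TW]
  show "C1x_on ?W (\<lambda>t. point_source R (z t) (c t))"
  proof (rule C1x_onI[OF point_source_has_derivative])
    show "continuous_on ?W (\<lambda>p. point_source R (z (fst p)) (c (fst p)) (snd p))"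
      unfolding point_source_def by (intro continuous_intros c ne)
    show "continuous_on ?W (\<lambda>p. point_source_deriv R (z (fst p)) (c (fst p)) (snd p) h)" for h
      unfolding point_source_deriv_def Let_def by (intro continuous_intros c ne ne2)
  qed auto
  show "point_source R (z t) (c t) w = 0" if "2 - 2 / R\<^sup>2 * ((w - z t) \<bullet> (w - z t)) > 1" for t w
    using that by (simp add: point_source_def cutoff_le0)
qed

lemma C1x_on_cutoff_at_infinity:
  assumes "C1x_on (T \<times> UNIV) V"
  shows "C1x_on (T \<times> UNIV) (\<lambda>t w. cutoff (w \<bullet> w - \<Lambda>) *\<^sub>R V t w)"
proof -
  have s: "((\<lambda>w. w \<bullet> w - \<Lambda>) has_derivative (\<lambda>h. 2 * (w \<bullet> h))) (at w)" for w :: complex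
    by (auto intro!: derivative_eq_intros simp: inner_commute)
  show ?thesis
    by (rule C1x_onI[OF has_derivative_scaleR[OF has_derivative_cutoff(1)[OF s] C1x_onD(1)[OF assms]]])
       (intro continuous_intros C1x_onD(2,3)[OF assms] | assumption)+
qed

text \<open>The closed inequality suffices, because \<open>cutoff'\<close> vanishes at 0.\<close>

lemma frechet_derivative_cutoff_inside:
  fixes V :: "complex \<Rightarrow> complex"
  assumes "(V has_derivative V') (at w)" "w \<bullet> w \<le> \<Lambda>"
  shows "((\<lambda>w. cutoff (w \<bullet> w - \<Lambda>) *\<^sub>R V w) has_derivative V') (at w)"
proof -
  have s: "((\<lambda>w. w \<bullet> w - \<Lambda>) has_derivative (\<lambda>h. 2 * (w \<bullet> h))) (at w)"
    by (auto intro!: derivative_eq_intros simp: inner_commute)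
  show ?thesis
    by (rule has_derivative_eq_rhs[OF has_derivative_scaleR[OF has_derivative_cutoff(1)[OF s] assms(1)]])
       (use assms(2) in \<open>simp add: cutoff_le0\<close>)
qed

section \<open>The velocity field of moving disks\<close>

lemma DERIV_Ln_quotient:
  assumes "(w - p) / k \<notin> \<real>\<^sub>\<le>\<^sub>0"
  shows "((\<lambda>w. Ln ((w - p) / k)) has_field_derivative 1 / (w - p)) (at w)"
proof -
  have "k \<noteq> 0" "w \<noteq> p" using assms by auto
  then show ?thesis
    using assms by (auto intro!: derivative_eq_intros simp: field_simps)
qed

lemma DERIV_Ln_quotient_self:
  assumes "(w - p) / w \<notin> \<real>\<^sub>\<le>\<^sub>0"
  shows "((\<lambda>w. Ln ((w - p) / w)) has_field_derivative 1 / (w - p) - 1 / w) (at w)"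
proof -
  have "w \<noteq> 0" "w \<noteq> p" using assms by auto
  then show ?thesis
    using assms by (auto intro!: derivative_eq_intros simp: field_simps)
qed

text \<open>The reason why the principal branch of the logarithm is available near a boundary circle.\<close>

lemma not_nonpos_Reals_of_dist_1: "norm (u - 1 :: complex) < 1 \<Longrightarrow> u \<notin> \<real>\<^sub>\<le>\<^sub>0"
  using abs_Re_le_cmod[of "u - 1"] by (auto simp: complex_nonpos_Reals_iff)

text \<open>Disks of centre \<open>z i t\<close> and radius \<open>r i t\<close>, \<open>c i\<close> being half the derivative of \<open>(r i)\<^sup>2\<close>, that keep a
  distance of at least \<open>2 \<delta>\<close> from each other and from the circle of radius \<open>t R0\<close>. The radii are
  bounded below by the constants \<open>R i\<close>, so that the point sources can be regularized within the disks.\<close>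

locale moving_disks =
  fixes I :: "'i set" and lam R0 \<delta> :: real
    and z z' :: "'i \<Rightarrow> real \<Rightarrow> complex" and r c :: "'i \<Rightarrow> real \<Rightarrow> real" and R :: "'i \<Rightarrow> real"
  assumes finite_I: "finite I" and lam: "1 \<le> lam" and \<delta>: "\<delta> > 0" and R0: "R0 > 0"
    and z_deriv: "\<And>i t. i \<in> I \<Longrightarrow> t \<in> {1..lam} \<Longrightarrow> (z i has_vector_derivative z' i t) (at t within {1..lam})"
    and r_deriv: "\<And>i t. i \<in> I \<Longrightarrow> t \<in> {1..lam} \<Longrightarrow> (r i has_real_derivative c i t / r i t) (at t within {1..lam})"
    and cont_z': "\<And>i. i \<in> I \<Longrightarrow> continuous_on {1..lam} (z' i)"
    and cont_c: "\<And>i. i \<in> I \<Longrightarrow> continuous_on {1..lam} (c i)"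
    and R_pos: "\<And>i. i \<in> I \<Longrightarrow> R i > 0"
    and R_le_r: "\<And>i t. i \<in> I \<Longrightarrow> t \<in> {1..lam} \<Longrightarrow> R i \<le> r i t"
    and apart: "\<And>i j t. i \<in> I \<Longrightarrow> j \<in> I \<Longrightarrow> i \<noteq> j \<Longrightarrow> t \<in> {1..lam} \<Longrightarrow>
      r i t + r j t + 2 * \<delta> \<le> norm (z i t - z j t)"
    and inside: "\<And>i t. i \<in> I \<Longrightarrow> t \<in> {1..lam} \<Longrightarrow> norm (z i t) + r i t + 2 * \<delta> \<le> t * R0"
    and flux: "\<And>t. t \<in> {1..lam} \<Longrightarrow> (\<Sum>i\<in>I. c i t) = t * R0\<^sup>2"
begin

lemma r_pos: "i \<in> I \<Longrightarrow> t \<in> {1..lam} \<Longrightarrow> r i t > 0"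
  using R_pos R_le_r less_le_trans by blast

lemma cont_z: "i \<in> I \<Longrightarrow> continuous_on {1..lam} (z i)"
  using z_deriv by (meson continuous_on_eq_continuous_within has_vector_derivative_continuous)

lemma cont_r: "i \<in> I \<Longrightarrow> continuous_on {1..lam} (r i)"
  using r_deriv by (meson continuous_on_eq_continuous_within DERIV_continuous)

text \<open>Adding the conjugate derivative of \<open>hole_potential i\<close> to the sum of all sources leaves
  \<open>z' i + c i / cnj (w - z i)\<close>. The normalization by \<open>z i t - z j t\<close> keeps the argument of \<open>Ln\<close> in the
  disk of radius one about 1 near the \<open>i\<close>-th hole.\<close>

definition "hole_potential i t w =
  cnj (z' i t) * (w - z i t) - (\<Sum>j\<in>I - {i}. of_real (c j t) * Ln ((w - z j t) / (z i t - z j t)))"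
definition "hole_potential' i t w = cnj (z' i t) - (\<Sum>j\<in>I - {i}. of_real (c j t) * (1 / (w - z j t)))"
definition "hole_potential'' i t w = - (\<Sum>j\<in>I - {i}. of_real (c j t) * - (1 / (w - z j t)\<^sup>2))"

text \<open>Adding the conjugate derivative of \<open>rim_potential\<close> to the sum of all sources replaces them by a
  single source at the origin. The arguments of the logarithms are close to 1 in the same sense
  wherever \<open>\<bar>w\<bar> > \<bar>z j t\<bar>\<close>.\<close>

definition "rim_potential t w = - (\<Sum>j\<in>I. of_real (c j t) * Ln ((w - z j t) / w))"
definition "rim_potential' t w = - (\<Sum>j\<in>I. of_real (c j t) * (1 / (w - z j t) - 1 / w))"
definition "rim_potential'' t w = - (\<Sum>j\<in>I. of_real (c j t) * (- (1 / (w - z j t)\<^sup>2) - - (1 / w\<^sup>2)))"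

text \<open>The widths of the cutoffs: as \<open>r\<^sup>2 + 2 \<delta>\<^sup>2 \<le> (r + 2 \<delta>)\<^sup>2\<close>, the region where the cutoff argument is
  below 2 stays away from the other boundary circles, and similarly for the outer circle, where the
  sign is reversed.\<close>

definition "hole_block i t = stream_block (1 / \<delta>\<^sup>2) ((r i t)\<^sup>2) (z i t) (hole_potential i t) (hole_potential' i t)"
definition "rim_block t = stream_block (- 1 / \<delta>\<^sup>2) ((t * R0)\<^sup>2) 0 (rim_potential t) (rim_potential' t)"

definition "raw_velocity t w =
  (\<Sum>j\<in>I. point_source (R j) (z j t) (c j t) w) + ((\<Sum>i\<in>I. hole_block i t w) + rim_block t w)"

text \<open>The last cutoff gives the velocity compact support, hence a globally bounded derivative; it acts
  outside the disk of radius \<open>lam R0\<close>, which contains all moving domains.\<close>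

definition "velocity t w = cutoff (w \<bullet> w - (lam * R0)\<^sup>2) *\<^sub>R raw_velocity t w"

text \<open>Where the cutoff of the \<open>i\<close>-th block has not yet ended, \<open>w\<close> is closer to \<open>z i t\<close> than \<open>z j t\<close> is, so
  the potential is holomorphic there.\<close>

lemma near_hole:
  assumes "i \<in> I" "t \<in> {1..lam}" "1 / \<delta>\<^sup>2 * ((w - z i t) \<bullet> (w - z i t) - (r i t)\<^sup>2) < 2" "j \<in> I - {i}"
  shows "(w - z j t) / (z i t - z j t) \<notin> \<real>\<^sub>\<le>\<^sub>0" "z i t \<noteq> z j t" "w \<noteq> z j t"
proof -
  have r: "r i t > 0" "r j t > 0" using assms r_pos by auto
  have "(norm (w - z i t))\<^sup>2 < (r i t)\<^sup>2 + 2 * \<delta>\<^sup>2"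
    using assms(3) \<delta> by (simp add: power2_norm_eq_inner field_simps)
  also have "\<dots> \<le> (r i t + 2 * \<delta>)\<^sup>2"
    using r \<delta> by (simp add: power2_eq_square algebra_simps)
  finally have "norm (w - z i t) < r i t + 2 * \<delta>"
    by (rule power2_less_imp_less) (use r \<delta> in simp)
  then have *: "norm (w - z i t) < norm (z i t - z j t)"
    using apart[of i j t] assms r by auto
  then show "z i t \<noteq> z j t" "w \<noteq> z j t" by (auto simp: norm_minus_commute)
  then have "(w - z j t) / (z i t - z j t) - 1 = (w - z i t) / (z i t - z j t)"
    by (simp add: field_simps)
  then show "(w - z j t) / (z i t - z j t) \<notin> \<real>\<^sub>\<le>\<^sub>0"
    using * \<open>z i t \<noteq> z j t\<close> by (intro not_nonpos_Reals_of_dist_1) (simp add: norm_divide)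
qed

text \<open>Where the cutoff of the outer block has not yet ended, \<open>\<bar>w\<bar> > t R0 - 2 \<delta>\<close>. This uses \<open>2 \<delta> \<le> t R0\<close>, which
  holds because the domain contains at least the disk \<open>j\<close>.\<close>

lemma near_rim:
  assumes "t \<in> {1..lam}" "- 1 / \<delta>\<^sup>2 * ((w - 0) \<bullet> (w - 0) - (t * R0)\<^sup>2) < 2" "j \<in> I"
  shows "(w - z j t) / w \<notin> \<real>\<^sub>\<le>\<^sub>0" "w \<noteq> z j t" "w \<noteq> 0"
proof -
  have r: "r j t > 0" using assms r_pos by auto
  note ins = inside[OF assms(3,1)]
  have "0 \<le> \<delta> * (t * R0 - 2 * \<delta>)"
    using ins r \<delta> norm_ge_zero[of "z j t"] by (intro mult_nonneg_nonneg) linarith+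
  then have "2 * \<delta>\<^sup>2 \<le> \<delta> * (t * R0)" by (simp add: power2_eq_square algebra_simps)
  moreover have "(t * R0 - 2 * \<delta>)\<^sup>2 = (t * R0)\<^sup>2 - 4 * (\<delta> * (t * R0)) + 4 * \<delta>\<^sup>2"
    by (simp add: power2_eq_square algebra_simps)
  moreover have "(t * R0)\<^sup>2 - 2 * \<delta>\<^sup>2 < (norm w)\<^sup>2"
    using assms(2) \<delta> by (simp add: power2_norm_eq_inner field_simps)
  ultimately have "(t * R0 - 2 * \<delta>)\<^sup>2 < (norm w)\<^sup>2" using zero_le_power2[of \<delta>] by linarith
  then have "t * R0 - 2 * \<delta> < norm w" by (rule power2_less_imp_less) simp
  then have *: "norm (z j t) < norm w" using ins r by linarith
  then show "w \<noteq> 0" "w \<noteq> z j t" by auto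
  then have "(w - z j t) / w - 1 = - (z j t / w)" by (simp add: field_simps)
  then show "(w - z j t) / w \<notin> \<real>\<^sub>\<le>\<^sub>0"
    using * \<open>w \<noteq> 0\<close> by (intro not_nonpos_Reals_of_dist_1) (simp add: norm_divide)
qed

lemma hole_block_C1_div_free:
  assumes i: "i \<in> I"
  shows "C1x_on ({1..lam} \<times> UNIV) (hole_block i)"
    and "t \<in> {1..lam} \<Longrightarrow> plane_div (frechet_derivative (hole_block i t) (at w)) = 0"
proof -
  let ?W = "{p \<in> {1..lam} \<times> UNIV. 1 / \<delta>\<^sup>2 * ((snd p - z i (fst p)) \<bullet> (snd p - z i (fst p)) - (r i (fst p))\<^sup>2) < 2}"
  have near: "(w - z j t) / (z i t - z j t) \<notin> \<real>\<^sub>\<le>\<^sub>0" "z i t \<noteq> z j t" "w \<noteq> z j t"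
    if "(t, w) \<in> ?W" "j \<in> I - {i}" for t w j
    using near_hole[OF i _ _ that(2), of t w] that(1) by auto
  have TW: "fst ` ?W \<subseteq> {1..lam}" by auto
  have near': "(snd p - z j (fst p)) / (z i (fst p) - z j (fst p)) \<notin> \<real>\<^sub>\<le>\<^sub>0"
      "z i (fst p) - z j (fst p) \<noteq> 0" "snd p - z j (fst p) \<noteq> 0"
    if "p \<in> ?W" "j \<in> I - {i}" for p j
    using near[OF _ that(2), of "fst p" "snd p"] that(1) by simp_all
  note c' = continuous_on_fst_compose[OF cont_c TW] continuous_on_fst_compose[OF cont_z TW]
    continuous_on_fst_compose[OF cont_z' TW]
  have F: "(hole_potential i t has_field_derivative hole_potential' i t w) (at w)" if "(t, w) \<in> ?W" for t w
    unfolding hole_potential_def hole_potential'_def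
    by (intro DERIV_diff DERIV_sum DERIV_cmult DERIV_Ln_quotient near[OF that])
       (auto intro!: derivative_eq_intros)
  have F1: "(hole_potential' i t has_field_derivative hole_potential'' i t w) (at w)" if "(t, w) \<in> ?W" for t w
  proof -
    have "((\<lambda>w. 1 / (w - z j t)) has_field_derivative - (1 / (w - z j t)\<^sup>2)) (at w)" if "j \<in> I - {i}" for j
      using near(3)[OF \<open>(t, w) \<in> ?W\<close> that] by (auto intro!: derivative_eq_intros simp: power2_eq_square)
    then have "(hole_potential' i t has_field_derivative
        0 - (\<Sum>j\<in>I - {i}. of_real (c j t) * - (1 / (w - z j t)\<^sup>2))) (at w)"
      unfolding hole_potential'_def by (intro DERIV_diff DERIV_sum DERIV_cmult DERIV_const)
    then show ?thesis by (simp add: hole_potential''_def)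
  qed
  have contF: "continuous_on ?W (\<lambda>p. hole_potential i (fst p) (snd p))"
    unfolding hole_potential_def by (intro continuous_intros c' i ballI near' power_not_zero; (assumption | simp))
  have contF1: "continuous_on ?W (\<lambda>p. hole_potential' i (fst p) (snd p))"
    unfolding hole_potential'_def by (intro continuous_intros c' i ballI near' power_not_zero; (assumption | simp))
  have contF2: "continuous_on ?W (\<lambda>p. hole_potential'' i (fst p) (snd p))"
    unfolding hole_potential''_def by (intro continuous_intros c' i ballI near' power_not_zero; (assumption | simp))
  have cr: "continuous_on {1..lam} (\<lambda>t. (r i t)\<^sup>2)" by (intro continuous_intros cont_r i)
  show "C1x_on ({1..lam} \<times> UNIV) (hole_block i)"
    unfolding hole_block_def[abs_def]
    by (rule C1x_on_stream_block[OF cr cont_z[OF i] refl F F1 contF contF1 contF2])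
  show "plane_div (frechet_derivative (hole_block i t) (at w)) = 0" if "t \<in> {1..lam}"
    unfolding hole_block_def[abs_def]
    by (rule plane_div_frechet_stream_block[OF cr cont_z[OF i] refl F F1 contF contF1 contF2 that])
qed

lemma rim_block_C1_div_free:
  shows "C1x_on ({1..lam} \<times> UNIV) rim_block"
    and "t \<in> {1..lam} \<Longrightarrow> plane_div (frechet_derivative (rim_block t) (at w)) = 0"
proof -
  let ?W = "{p \<in> {1..lam} \<times> UNIV. - 1 / \<delta>\<^sup>2 * ((snd p - 0) \<bullet> (snd p - 0) - (fst p * R0)\<^sup>2) < 2}"
  have near: "(w - z j t) / w \<notin> \<real>\<^sub>\<le>\<^sub>0" "w \<noteq> z j t" "w \<noteq> 0" if "(t, w) \<in> ?W" "j \<in> I" for t w j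
    using near_rim[OF _ _ that(2), of t w] that(1) by auto
  have TW: "fst ` ?W \<subseteq> {1..lam}" by auto
  have near': "(snd p - z j (fst p)) / snd p \<notin> \<real>\<^sub>\<le>\<^sub>0" "snd p - z j (fst p) \<noteq> 0" "snd p \<noteq> 0"
    if "p \<in> ?W" "j \<in> I" for p j
    using near[OF _ that(2), of "fst p" "snd p"] that(1) by simp_all
  note c' = continuous_on_fst_compose[OF cont_c TW] continuous_on_fst_compose[OF cont_z TW]
  have F: "(rim_potential t has_field_derivative rim_potential' t w) (at w)" if "(t, w) \<in> ?W" for t w
    unfolding rim_potential_def rim_potential'_def
    by (intro DERIV_minus DERIV_sum DERIV_cmult DERIV_Ln_quotient_self near[OF that])
  have F1: "(rim_potential' t has_field_derivative rim_potential'' t w) (at w)" if "(t, w) \<in> ?W" for t w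
  proof -
    have "((\<lambda>w. 1 / (w - p)) has_field_derivative - (1 / (w - p)\<^sup>2)) (at w)" if "w \<noteq> p" for p
      using that by (auto intro!: derivative_eq_intros simp: power2_eq_square)
    from this[of 0] this show ?thesis
      unfolding rim_potential'_def rim_potential''_def using near[OF that]
      by (intro DERIV_minus DERIV_sum DERIV_cmult DERIV_diff) auto
  qed
  have contF: "continuous_on ?W (\<lambda>p. rim_potential (fst p) (snd p))"
    unfolding rim_potential_def by (intro continuous_intros c' ballI near' power_not_zero; assumption)
  have contF1: "continuous_on ?W (\<lambda>p. rim_potential' (fst p) (snd p))"
    unfolding rim_potential'_def by (intro continuous_intros c' ballI near' power_not_zero; assumption)
  have contF2: "continuous_on ?W (\<lambda>p. rim_potential'' (fst p) (snd p))"
    unfolding rim_potential''_def by (intro continuous_intros c' ballI near' power_not_zero; assumption)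
  have cr: "continuous_on {1..lam} (\<lambda>t. (t * R0)\<^sup>2)" by (intro continuous_intros)
  have c0: "continuous_on {1..lam} (\<lambda>t. 0::complex)" by (intro continuous_intros)
  show "C1x_on ({1..lam} \<times> UNIV) rim_block"
    unfolding rim_block_def[abs_def]
    by (rule C1x_on_stream_block[OF cr c0 refl F F1 contF contF1 contF2])
  show "plane_div (frechet_derivative (rim_block t) (at w)) = 0" if "t \<in> {1..lam}"
    unfolding rim_block_def[abs_def]
    by (rule plane_div_frechet_stream_block[OF cr c0 refl F F1 contF contF1 contF2 that])
qed

lemma C1x_source: "j \<in> I \<Longrightarrow> C1x_on ({1..lam} \<times> UNIV) (\<lambda>t. point_source (R j) (z j t) (c j t))"
  by (intro C1x_on_point_source R_pos cont_z cont_c)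

lemma velocity_C1: "C1x_on ({1..lam} \<times> UNIV) velocity"
  unfolding velocity_def[abs_def] raw_velocity_def[abs_def]
  by (intro C1x_on_cutoff_at_infinity C1x_on_add C1x_on_sum finite_I C1x_source hole_block_C1_div_free rim_block_C1_div_free)

lemma velocity_support: "w \<bullet> w \<ge> (lam * R0)\<^sup>2 + 1 \<Longrightarrow> velocity t w = 0"
  by (simp add: velocity_def cutoff_ge1)

lemma in_big_disk:
  assumes "t \<in> {1..lam}" "norm (w :: complex) \<le> t * R0"
  shows "w \<bullet> w \<le> (lam * R0)\<^sup>2"
proof -
  have "norm w \<le> lam * R0"
    using order_trans[OF assms(2) mult_right_mono[of t lam R0]] assms(1) R0 by simp
  then show ?thesis by (simp add: power_mono flip: power2_norm_eq_inner)
qed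

lemma velocity_eq_raw: "t \<in> {1..lam} \<Longrightarrow> norm w \<le> t * R0 \<Longrightarrow> velocity t w = raw_velocity t w"
  using in_big_disk[of t w] by (simp add: velocity_def cutoff_le0)

lemma hole_block_far:
  assumes "i \<in> I" "t \<in> {1..lam}" "norm (w - z i t) \<ge> r i t + 2 * \<delta>"
  shows "hole_block i t w = 0"
proof -
  have "(r i t)\<^sup>2 + \<delta>\<^sup>2 \<le> (r i t + 2 * \<delta>)\<^sup>2"
    using r_pos[OF assms(1,2)] \<delta> by (simp add: power2_eq_square algebra_simps)
  also have "\<dots> \<le> (norm (w - z i t))\<^sup>2"
    using assms(3) r_pos[OF assms(1,2)] \<delta> by (intro power_mono) auto
  finally show ?thesis
    unfolding hole_block_def using \<delta>
    by (intro stream_block_zero) (simp add: power2_norm_eq_inner field_simps)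
qed

lemma rim_block_far:
  assumes "t \<in> {1..lam}" "norm w \<le> t * R0 - 2 * \<delta>"
  shows "rim_block t w = 0"
proof -
  have "(norm w)\<^sup>2 \<le> (t * R0 - 2 * \<delta>)\<^sup>2"
    using assms(2) by (intro power_mono) auto
  moreover have "0 \<le> \<delta> * (t * R0 - 2 * \<delta>)"
    using assms \<delta> norm_ge_zero[of w] by (intro mult_nonneg_nonneg) linarith+
  then have "2 * \<delta>\<^sup>2 \<le> \<delta> * (t * R0)" by (simp add: power2_eq_square algebra_simps)
  moreover have "(t * R0 - 2 * \<delta>)\<^sup>2 = (t * R0)\<^sup>2 - 4 * (\<delta> * (t * R0)) + 4 * \<delta>\<^sup>2"
    by (simp add: power2_eq_square algebra_simps)
  ultimately have "(norm w)\<^sup>2 + \<delta>\<^sup>2 \<le> (t * R0)\<^sup>2"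
    using zero_le_power2[of \<delta>] by linarith
  then show ?thesis
    unfolding rim_block_def using \<delta>
    by (intro stream_block_zero) (simp add: power2_norm_eq_inner field_simps)
qed

lemma source_value:
  assumes "j \<in> I" "t \<in> {1..lam}" "norm (w - z j t) \<ge> r j t"
  shows "point_source (R j) (z j t) (c j t) w = cnj (of_real (c j t) * (1 / (w - z j t)))"
    "plane_div (frechet_derivative (point_source (R j) (z j t) (c j t)) (at w)) = 0"
  using point_source_outside[OF R_pos[OF assms(1)], of w "z j t" "c j t"] R_le_r[OF assms(1,2)] assms(3) by auto

text \<open>All other corrections vanish here, the one of the \<open>i\<close>-th hole is the full conjugate derivative
  of its potential, and every source has its unregularized value.\<close>

lemma velocity_on_hole:
  assumes i: "i \<in> I" and t: "t \<in> {1..lam}" and w: "norm (w - z i t) = r i t"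
  shows "velocity t w = z' i t + of_real (c i t) / cnj (w - z i t)"
proof -
  have far: "norm (w - z j t) \<ge> r j t + 2 * \<delta>" if "j \<in> I" "j \<noteq> i" for j
    using apart[OF i that(1) _ t] that(2) w norm_triangle_sub[of "z i t - z j t" "z i t - w"]
    by (simp add: norm_minus_commute)
  then have far': "norm (w - z j t) \<ge> r j t" if "j \<in> I" for j
    using that w \<delta> by (cases "j = i") (auto, smt (verit))
  have ins: "norm w \<le> t * R0 - 2 * \<delta>"
    using inside[OF i t] w norm_triangle_sub[of w "z i t"] by linarith
  have "(\<Sum>j\<in>I. hole_block j t w) = hole_block i t w + (\<Sum>j\<in>I - {i}. hole_block j t w)"
    using i finite_I by (simp add: sum.remove)
  also have "(\<Sum>j\<in>I - {i}. hole_block j t w) = 0"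
    using far t by (intro sum.neutral) (auto intro: hole_block_far)
  also have "hole_block i t w = cnj (hole_potential' i t w)"
    unfolding hole_block_def using w by (intro stream_block_on_circle) (simp flip: power2_norm_eq_inner)
  finally have h: "(\<Sum>j\<in>I. hole_block j t w) = cnj (hole_potential' i t w)" by simp
  have s: "(\<Sum>j\<in>I. point_source (R j) (z j t) (c j t) w) = (\<Sum>j\<in>I. cnj (of_real (c j t) * (1 / (w - z j t))))"
    using far' t by (intro sum.cong source_value) auto
  also have "\<dots> = cnj (of_real (c i t) * (1 / (w - z i t))) + cnj (\<Sum>j\<in>I - {i}. of_real (c j t) * (1 / (w - z j t)))"
    using i finite_I by (simp add: sum.remove cnj_sum)
  finally have "raw_velocity t w = z' i t + cnj (of_real (c i t) * (1 / (w - z i t)))"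
    unfolding raw_velocity_def h rim_block_far[OF t ins] hole_potential'_def by simp
  then show ?thesis using velocity_eq_raw[OF t] ins \<delta> by simp
qed

text \<open>The correction turns the sum of all sources into a single source at the origin, whose strength
  \<open>t R0\<^sup>2\<close> is given by the balance of the fluxes.\<close>

lemma velocity_on_rim:
  assumes t: "t \<in> {1..lam}" and w: "norm w = t * R0"
  shows "velocity t w = of_real (t * R0\<^sup>2) / cnj w"
proof -
  have far: "norm (w - z j t) \<ge> r j t + 2 * \<delta>" if "j \<in> I" for j
    using inside[OF that t] w norm_triangle_sub[of w "z j t"] by linarith
  then have far': "norm (w - z j t) \<ge> r j t" if "j \<in> I" for j
    using that \<delta> by force
  have h: "(\<Sum>j\<in>I. hole_block j t w) = 0"
    using far t by (intro sum.neutral) (auto intro: hole_block_far)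
  have o: "rim_block t w = cnj (rim_potential' t w)"
    unfolding rim_block_def using w by (intro stream_block_on_circle) (simp flip: power2_norm_eq_inner)
  have s: "(\<Sum>j\<in>I. point_source (R j) (z j t) (c j t) w) = (\<Sum>j\<in>I. cnj (of_real (c j t) * (1 / (w - z j t))))"
    using far' t by (intro sum.cong source_value) auto
  have "raw_velocity t w = cnj ((\<Sum>j\<in>I. of_real (c j t)) * (1 / w))"
    unfolding raw_velocity_def h s o rim_potential'_def
    by (simp add: right_diff_distrib sum_subtractf sum_divide_distrib cnj_sum)
  also have "(\<Sum>j\<in>I. complex_of_real (c j t)) = of_real (t * R0\<^sup>2)"
    using flux[OF t] by (simp flip: of_real_sum)
  finally show ?thesis using velocity_eq_raw[OF t] w by simp
qed

text \<open>The regularized sources have divergence only inside the disks, and the blocks have none anywhere.\<close>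

lemma velocity_divergence:
  assumes t: "t \<in> {1..lam}" and w: "norm w < t * R0" "\<And>i. i \<in> I \<Longrightarrow> norm (w - z i t) > r i t"
  shows "plane_div (frechet_derivative (velocity t) (at w)) = 0"
proof -
  note d1 = C1x_onD(1)[OF C1x_source, of _ t w] and d2 = C1x_onD(1)[OF hole_block_C1_div_free(1), of _ t w]
    and d3 = C1x_onD(1)[OF rim_block_C1_div_free(1), of t w]
  have "(raw_velocity t has_derivative (\<lambda>h. (\<Sum>j\<in>I. frechet_derivative (point_source (R j) (z j t) (c j t)) (at w) h)
     + ((\<Sum>i\<in>I. frechet_derivative (hole_block i t) (at w) h) + frechet_derivative (rim_block t) (at w) h))) (at w)"
    unfolding raw_velocity_def[abs_def] using d1 d2 d3 t by (intro has_derivative_add has_derivative_sum) auto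
  from frechet_derivative_cutoff_inside[OF this in_big_disk[OF t]] w(1)
  have D: "frechet_derivative (velocity t) (at w) = (\<lambda>h. (\<Sum>j\<in>I. frechet_derivative (point_source (R j) (z j t) (c j t)) (at w) h)
     + ((\<Sum>i\<in>I. frechet_derivative (hole_block i t) (at w) h) + frechet_derivative (rim_block t) (at w) h))"
    unfolding velocity_def[abs_def] by (intro frechet_derivative_at[symmetric]) simp
  show ?thesis
    unfolding D plane_div_simps(1) plane_div_simps(3)[OF finite_I]
    using t w source_value(2)[of _ t w] hole_block_C1_div_free(2)[of _ t w] rim_block_C1_div_free(2)[of t w]
    by (simp add: less_imp_le)
qed

end

section \<open>The area-preserving isotopy\<close>

definition frechet_blinfun :: "(complex \<Rightarrow> complex) \<Rightarrow> complex \<Rightarrow> complex \<Rightarrow>\<^sub>L complex" where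
  "frechet_blinfun f w = Blinfun (frechet_derivative f (at w))"

lemma frechet_blinfun_apply:
  assumes "C1x_on (T \<times> UNIV) V" "t \<in> T"
  shows "blinfun_apply (frechet_blinfun (V t) w) = frechet_derivative (V t) (at w)"
proof -
  have "(V t has_derivative frechet_derivative (V t) (at w)) (at w)"
    using assms by (intro C1x_onD(1)) auto
  then show ?thesis
    unfolding frechet_blinfun_def
    by (intro bounded_linear_Blinfun_apply) (rule has_derivative_bounded_linear)
qed

text \<open>The spatial derivative is bounded by compactness on a large ball and vanishes outside it.\<close>

lemma c1_field_of_compact_support:
  fixes V :: "real \<Rightarrow> complex \<Rightarrow> complex"
  assumes "a \<le> b" and V: "C1x_on ({a..b} \<times> UNIV) V"
    and supp: "\<And>t w. w \<bullet> w \<ge> \<Lambda> \<Longrightarrow> V t w = 0"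
  obtains K where "c1_field a b K V (\<lambda>t. frechet_blinfun (V t))"
proof -
  let ?DV = "\<lambda>t. frechet_blinfun (V t)"
  have der: "(V t has_derivative frechet_derivative (V t) (at w)) (at w)" if "t \<in> {a..b}" for t w
    using C1x_onD(1)[OF V] that by simp
  note app = frechet_blinfun_apply[OF V]
  have contD: "continuous_on ({a..b} \<times> UNIV) (\<lambda>p. ?DV (fst p) (snd p))"
  proof (rule continuous_on_blinfun_componentwise)
    show "continuous_on ({a..b} \<times> UNIV) (\<lambda>p. ?DV (fst p) (snd p) h)" for h
      by (rule continuous_on_eq[OF C1x_onD(3)[OF V, of h]]) (auto simp: app)
  qed
  define M where "M = \<bar>\<Lambda>\<bar> + 1"
  have "bounded ((\<lambda>p. ?DV (fst p) (snd p)) ` ({a..b} \<times> cball 0 M))"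
    by (intro compact_imp_bounded compact_continuous_image compact_Times compact_Icc compact_cball
        continuous_on_subset[OF contD]) auto
  then obtain K where K: "\<And>t w. t \<in> {a..b} \<Longrightarrow> w \<in> cball 0 M \<Longrightarrow> norm (?DV t w) \<le> K"
    unfolding bounded_iff by fastforce
  have far: "?DV t w = 0" if "t \<in> {a..b}" "w \<notin> cball 0 M" for t w
  proof -
    have "M < norm w" using that by simp
    then have "M * M < norm w * norm w" by (intro mult_strict_mono) (auto simp: M_def)
    moreover have "\<Lambda> \<le> M * M"
      using mult_mono[of 1 M "\<bar>\<Lambda>\<bar>" M] by (auto simp: M_def)
    ultimately have "w \<bullet> w - \<Lambda> + 1 > 1" by (simp add: dot_square_norm power2_eq_square)
    from frechet_derivative_locally_zero(2)[where \<alpha> = "\<lambda>w. w \<bullet> w - \<Lambda> + 1", OF _ _ this, of "V t"]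
    have "frechet_derivative (V t) (at w) = (\<lambda>_. 0)"
      using supp by (simp add: continuous_intros)
    then show ?thesis by (intro blinfun_eqI) (simp add: app[OF that(1)])
  qed
  have "c1_field a b (max 0 K) V ?DV"
  proof unfold_locales
    show "norm (?DV t w) \<le> max 0 K" if "t \<in> {a..b}" for t w
      using K[OF that, of w] far[OF that, of w] by (cases "w \<in> cball 0 M") auto
  qed (use assms(1) C1x_onD(2)[OF V] contD der app in auto)
  then show thesis by (rule that)
qed

text \<open>The determinant of the matrix with columns \<open>x\<close> and \<open>y\<close>.\<close>

definition cross2 :: "complex \<Rightarrow> complex \<Rightarrow> real" where
  "cross2 x y = Re x * Im y - Im x * Re y"

lemma cross2_deriv_trace:
  assumes "linear A"
  shows "cross2 (A x) y + cross2 x (A y) = plane_div A * cross2 x y"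
proof -
  have A: "A x = Re x *\<^sub>R A 1 + Im x *\<^sub>R A \<i>" for x
  proof -
    have "x = Re x *\<^sub>R 1 + Im x *\<^sub>R \<i>" by (simp add: complex_eq_iff)
    then have "A x = A (Re x *\<^sub>R 1 + Im x *\<^sub>R \<i>)" by simp
    also have "\<dots> = Re x *\<^sub>R A 1 + Im x *\<^sub>R A \<i>"
      using assms by (simp add: linear_add linear_scale)
    finally show ?thesis .
  qed
  show ?thesis
    unfolding A[of x] A[of y] by (simp add: cross2_def plane_div_def algebra_simps)
qed

text \<open>Jacobi's formula: the derivative of the determinant of a fundamental system is the trace times
  the determinant.\<close>

lemma liouville_planar:
  assumes "a \<le> b"
    and "\<And>s. s \<in> {a..b} \<Longrightarrow> linear (A s)" "\<And>s. s \<in> {a..b} \<Longrightarrow> plane_div (A s) = 0"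
    and m: "\<And>s. s \<in> {a..b} \<Longrightarrow> (m has_vector_derivative A s (m s)) (at s within {a..b})"
    and k: "\<And>s. s \<in> {a..b} \<Longrightarrow> (k has_vector_derivative A s (k s)) (at s within {a..b})"
  shows "cross2 (m b) (k b) = cross2 (m a) (k a)"
proof -
  have der: "((\<lambda>s. cross2 (m s) (k s)) has_real_derivative 0) (at s within {a..b})" if s: "s \<in> {a..b}" for s
  proof -
    note R = bounded_linear.has_vector_derivative[OF bounded_linear_Re, folded has_real_derivative_iff_has_vector_derivative]
      and J = bounded_linear.has_vector_derivative[OF bounded_linear_Im, folded has_real_derivative_iff_has_vector_derivative]
    have "((\<lambda>s. cross2 (m s) (k s)) has_real_derivative cross2 (A s (m s)) (k s) + cross2 (m s) (A s (k s))) (at s within {a..b})"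
      unfolding cross2_def
      by (rule DERIV_cong[OF DERIV_diff[OF DERIV_mult[OF R[OF m[OF s]] J[OF k[OF s]]]
              DERIV_mult[OF J[OF m[OF s]] R[OF k[OF s]]]]])
         (simp add: algebra_simps)
    then show ?thesis using cross2_deriv_trace[OF assms(2)[OF s]] assms(3)[OF s] by simp
  qed
  then have "\<exists>c. \<forall>s\<in>{a..b}. cross2 (m s) (k s) = c"
    by (intro has_field_derivative_zero_constant) auto
  with \<open>a \<le> b\<close> show ?thesis by auto
qed

context moving_disks
begin

text \<open>The flow of the velocity. The circles are explicit trajectories by the boundary values of the
  velocity and uniqueness. A trajectory that left the moving domain would, by the intermediate value
  theorem, lie on one of the boundary circles at some time \<open>s\<close>. It would then coincide with an
  explicit trajectory at time \<open>s\<close>, hence at time 1 because the flow is injective.\<close>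

lemma exists_isotopy:
  obtains \<Phi> :: "real \<Rightarrow> complex \<Rightarrow> complex" and D :: "complex \<Rightarrow> complex \<Rightarrow> complex"
  where "continuous_on ({1..lam} \<times> UNIV) (\<lambda>p. \<Phi> (fst p) (snd p))"
    and "\<And>t. t \<in> {1..lam} \<Longrightarrow> inj (\<Phi> t)"
    and "\<And>w. \<Phi> 1 w = w"
    and "\<And>w. (\<Phi> lam has_derivative D w) (at w)"
    and "\<And>h. continuous_on UNIV (\<lambda>w. D w h)"
    and "\<And>w. norm w < R0 \<Longrightarrow> (\<And>i. i \<in> I \<Longrightarrow> norm (w - z i 1) > r i 1) \<Longrightarrow> cross2 (D w 1) (D w \<i>) = 1"
    and "\<And>i \<zeta>. i \<in> I \<Longrightarrow> norm \<zeta> = 1 \<Longrightarrow> \<Phi> lam (z i 1 + r i 1 *\<^sub>R \<zeta>) = z i lam + r i lam *\<^sub>R \<zeta>"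
    and "\<And>\<zeta>. norm \<zeta> = 1 \<Longrightarrow> \<Phi> lam (R0 *\<^sub>R \<zeta>) = (lam * R0) *\<^sub>R \<zeta>"
proof -
  obtain K where "c1_field 1 lam K velocity (\<lambda>t. frechet_blinfun (velocity t))"
    using c1_field_of_compact_support[OF lam velocity_C1 velocity_support] by blast
  then interpret fl: c1_field 1 lam K velocity "\<lambda>t. frechet_blinfun (velocity t)" .
  have t1: "1 \<in> {1..lam}" and tl: "lam \<in> {1..lam}" using lam by auto
  have hole: "fl.flow t (z i 1 + r i 1 *\<^sub>R \<zeta>) = z i t + r i t *\<^sub>R \<zeta>"
    if i: "i \<in> I" and \<zeta>: "norm \<zeta> = 1" and t: "t \<in> {1..lam}" for i t \<zeta>
  proof -
    have "fl.solution (\<lambda>t. z i t + r i t *\<^sub>R \<zeta>)"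
      unfolding fl.solution_def
    proof
      fix s assume s: "s \<in> {1..lam}"
      have r: "r i s > 0" by (rule r_pos[OF i s])
      have "velocity s (z i s + r i s *\<^sub>R \<zeta>) = z' i s + of_real (c i s) / cnj (r i s *\<^sub>R \<zeta>)"
        using velocity_on_hole[OF i s, of "z i s + r i s *\<^sub>R \<zeta>"] \<zeta> r by simp
      also have "of_real (c i s) / cnj (r i s *\<^sub>R \<zeta>) = (c i s / r i s) *\<^sub>R \<zeta>"
      proof -
        have "\<zeta> * cnj \<zeta> = 1" using \<zeta> by (simp add: complex_norm_square[symmetric])
        moreover from this have "cnj \<zeta> \<noteq> 0" by auto
        ultimately have "1 / cnj \<zeta> = \<zeta>" by (simp add: field_simps)
        then show ?thesis by (simp add: scaleR_conv_of_real divide_simps)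
      qed
      finally show "((\<lambda>t. z i t + r i t *\<^sub>R \<zeta>) has_vector_derivative velocity s (z i s + r i s *\<^sub>R \<zeta>)) (at s within {1..lam})"
        using has_vector_derivative_add[OF z_deriv[OF i s]
            has_vector_derivative_scaleR[OF r_deriv[OF i s] has_vector_derivative_const[of \<zeta>]]]
        by simp
    qed
    from fl.flow_unique[OF this t] show ?thesis by simp
  qed
  have rim: "fl.flow t (R0 *\<^sub>R \<zeta>) = (t * R0) *\<^sub>R \<zeta>" if \<zeta>: "norm \<zeta> = 1" and t: "t \<in> {1..lam}" for t \<zeta>
  proof -
    have "fl.solution (\<lambda>t. (t * R0) *\<^sub>R \<zeta>)"
      unfolding fl.solution_def
    proof
      fix s assume s: "s \<in> {1..lam}"
      have "velocity s ((s * R0) *\<^sub>R \<zeta>) = of_real (s * R0\<^sup>2) / cnj ((s * R0) *\<^sub>R \<zeta>)"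
        using s \<zeta> R0 by (intro velocity_on_rim) auto
      also have "\<dots> = R0 *\<^sub>R \<zeta>"
      proof -
        have "\<zeta> * cnj \<zeta> = 1" using \<zeta> by (simp add: complex_norm_square[symmetric])
        moreover from this have "cnj \<zeta> \<noteq> 0" by auto
        ultimately show ?thesis
          using s R0 by (simp add: scaleR_conv_of_real field_simps power2_eq_square)
      qed
      finally show "((\<lambda>t. (t * R0) *\<^sub>R \<zeta>) has_vector_derivative velocity s ((s * R0) *\<^sub>R \<zeta>)) (at s within {1..lam})"
        by (auto intro!: derivative_eq_intros)
    qed
    from fl.flow_unique[OF this t] show ?thesis by simp
  qed
  have inv_hole: "norm (fl.flow t w - z i t) > r i t"
    if w: "norm (w - z i 1) > r i 1" and i: "i \<in> I" and t: "t \<in> {1..lam}" for t w i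
  proof (rule ccontr)
    let ?f = "\<lambda>s. norm (fl.flow s w - z i s) - r i s"
    assume "\<not> norm (fl.flow t w - z i t) > r i t"
    moreover have "continuous_on {1..t} ?f"
      using t by (intro continuous_intros continuous_on_subset[OF fl.flow_continuous_time]
          continuous_on_subset[OF cont_z[OF i]] continuous_on_subset[OF cont_r[OF i]]) auto
    ultimately obtain s where s: "1 \<le> s" "s \<le> t" "?f s = 0"
      using IVT2'[of ?f t 0 1] w t by (auto simp: fl.flow_init)
    then have sT: "s \<in> {1..lam}" and "norm (fl.flow s w - z i s) = r i s" using t by auto
    define \<zeta> where "\<zeta> = (fl.flow s w - z i s) /\<^sub>R r i s"
    have "norm \<zeta> = 1" "fl.flow s w = z i s + r i s *\<^sub>R \<zeta>"
      using \<open>norm (fl.flow s w - z i s) = r i s\<close> r_pos[OF i sT] by (auto simp: \<zeta>_def)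
    then have "fl.flow s w = fl.flow s (z i 1 + r i 1 *\<^sub>R \<zeta>)" by (simp add: hole[OF i _ sT])
    then have "w = z i 1 + r i 1 *\<^sub>R \<zeta>" by (rule fl.flow_injective[OF sT])
    then show False using w \<open>norm \<zeta> = 1\<close> r_pos[OF i t1] by simp
  qed
  have inv_rim: "norm (fl.flow t w) < t * R0" if w: "norm w < R0" and t: "t \<in> {1..lam}" for t w
  proof (rule ccontr)
    let ?f = "\<lambda>s. norm (fl.flow s w) - s * R0"
    assume "\<not> norm (fl.flow t w) < t * R0"
    moreover have "continuous_on {1..t} ?f"
      using t by (intro continuous_intros continuous_on_subset[OF fl.flow_continuous_time]) auto
    ultimately obtain s where s: "1 \<le> s" "s \<le> t" "?f s = 0"
      using IVT'[of ?f 1 0 t] w t by (auto simp: fl.flow_init)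
    then have sT: "s \<in> {1..lam}" and n: "norm (fl.flow s w) = s * R0" using t by auto
    define \<zeta> where "\<zeta> = fl.flow s w /\<^sub>R (s * R0)"
    have "norm \<zeta> = 1" "fl.flow s w = (s * R0) *\<^sub>R \<zeta>"
      using n R0 s(1) by (auto simp: \<zeta>_def field_simps)
    then have "fl.flow s w = fl.flow s (R0 *\<^sub>R \<zeta>)" by (simp add: rim[OF _ sT])
    then have "w = R0 *\<^sub>R \<zeta>" by (rule fl.flow_injective[OF sT])
    then show False using w \<open>norm \<zeta> = 1\<close> R0 by simp
  qed
  show thesis
  proof (rule that[of fl.flow "fl.dflow lam"])
    fix w assume w: "norm w < R0" "\<And>i. i \<in> I \<Longrightarrow> norm (w - z i 1) > r i 1"
    have "cross2 (fl.dflow lam w 1) (fl.dflow lam w \<i>) = cross2 (fl.dflow 1 w 1) (fl.dflow 1 w \<i>)"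
    proof (rule liouville_planar[OF lam, where A = "\<lambda>s. blinfun_apply (frechet_blinfun (velocity s) (fl.flow s w))"])
      fix s assume s: "s \<in> {1..lam}"
      show "linear (blinfun_apply (frechet_blinfun (velocity s) (fl.flow s w)))"
        by (rule bounded_linear.linear[OF blinfun.bounded_linear_right])
      show "plane_div (frechet_blinfun (velocity s) (fl.flow s w)) = 0"
        unfolding frechet_blinfun_apply[OF velocity_C1 s] by (intro velocity_divergence s inv_rim inv_hole w)
    qed (rule fl.dflow_deriv, assumption)+
    then show "cross2 (fl.dflow lam w 1) (fl.dflow lam w \<i>) = 1"
      by (simp add: fl.dflow_init cross2_def)
  next
    show "inj (fl.flow t)" if "t \<in> {1..lam}" for t
      using fl.flow_injective[OF that] by (rule injI)
  qed (fact fl.flow_continuous fl.flow_init fl.flow_has_derivative[OF tl]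
      fl.dflow_continuous[OF tl] hole[OF _ _ tl] rim[OF _ tl])+
qed

end

section \<open>Deformation of the perforated disk\<close>

lemma finite_family_uniform_lower_bound:
  fixes g :: "'a \<Rightarrow> real \<Rightarrow> real"
  assumes "finite A" and "\<And>x. x \<in> A \<Longrightarrow> continuous_on {a..b} (g x)"
    and "\<And>x t. x \<in> A \<Longrightarrow> t \<in> {a..b} \<Longrightarrow> g x t > 0"
  shows "\<exists>\<delta>>0. \<forall>x\<in>A. \<forall>t\<in>{a..b}. \<delta> \<le> g x t"
proof (cases "a \<le> b")
  case False
  then show ?thesis by (intro exI[of _ 1]) auto
next
  case True
  show ?thesis using assms
  proof (induction A)
    case empty
    show ?case by (intro exI[of _ 1]) auto
  next
    case (insert x A)
    from insert.IH insert.prems obtain \<delta> where \<delta>: "\<delta> > 0" "\<forall>y\<in>A. \<forall>t\<in>{a..b}. \<delta> \<le> g y t"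
      by (metis insertCI)
    obtain s where s: "s \<in> {a..b}" "\<forall>t\<in>{a..b}. g x s \<le> g x t"
      using continuous_attains_inf[of "{a..b}" "g x"] insert.prems True by auto
    have "g x s > 0" using s(1) insert.prems by auto
    with \<delta> s show ?case
      by (intro exI[of _ "min \<delta> (g x s)"]) (auto simp: min_le_iff_disj)
  qed
qed

text \<open>Otherwise the point that divides the segment from \<open>x\<close> to \<open>y\<close> in the ratio \<open>r : s\<close> lies in both balls.\<close>

lemma disjoint_cballs_imp_dist:
  fixes x y :: "'a::real_normed_vector"
  assumes "cball x r \<inter> cball y s = {}" "r > 0" "s > 0"
  shows "r + s < dist x y"
proof (rule ccontr)
  assume "\<not> r + s < dist x y"
  then have d: "norm (y - x) \<le> r + s" by (simp add: dist_norm norm_minus_commute)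
  define p where "p = x + (r / (r + s)) *\<^sub>R (y - x)"
  have "dist x p = r / (r + s) * norm (y - x)"
    using assms by (simp add: p_def dist_norm)
  also have "\<dots> \<le> r / (r + s) * (r + s)" using assms by (intro mult_left_mono d) auto
  finally have "p \<in> cball x r" using assms by simp
  have "y - p = (s / (r + s)) *\<^sub>R (y - x)"
  proof -
    have "y - p = (1 - r / (r + s)) *\<^sub>R (y - x)" by (simp add: p_def scaleR_diff_left)
    also have "1 - r / (r + s) = s / (r + s)" using assms by (simp add: field_simps)
    finally show ?thesis .
  qed
  then have "dist y p = s / (r + s) * norm (y - x)"
    using assms by (simp add: dist_norm)
  also have "\<dots> \<le> s / (r + s) * (r + s)" using assms by (intro mult_left_mono d) auto
  finally have "p \<in> cball y s" using assms by simp
  with \<open>p \<in> cball x r\<close> assms(1) show False by blast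
qed

lemma complex_of_plane_axis: "complex_of_plane (axis 1 1) = 1" "complex_of_plane (axis 2 1) = \<i>"
  by (auto simp: complex_of_plane_def axis_def complex_eq_iff)

text \<open>The matrix, in the coordinates of the plane, of a real linear map \<open>A\<close> given in the complex coordinate.\<close>

definition plane_matrix :: "(complex \<Rightarrow> complex) \<Rightarrow> real^2^2" where
  "plane_matrix A = matrix (\<lambda>h. plane_of_complex (A (complex_of_plane h)))"

lemma det_plane_matrix: "det (plane_matrix A) = cross2 (A 1) (A \<i>)"
  by (simp add: plane_matrix_def matrix_def det_2 complex_of_plane_axis plane_of_complex_def cross2_def)

lemma plane_conjugate_has_derivative:
  assumes "(f has_derivative A) (at (complex_of_plane x))"
  shows "((\<lambda>x. plane_of_complex (f (complex_of_plane x))) has_derivative (\<lambda>h. plane_matrix A *v h)) (at x)"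
proof -
  have D: "((\<lambda>x. plane_of_complex (f (complex_of_plane x))) has_derivative (\<lambda>h. plane_of_complex (A (complex_of_plane h)))) (at x)"
    by (intro bounded_linear.has_derivative[OF bounded_linear_plane_of_complex]
        has_derivative_compose[OF bounded_linear.has_derivative[OF bounded_linear_complex_of_plane has_derivative_ident] assms])
  have "plane_matrix A *v h = plane_of_complex (A (complex_of_plane h))" for h
    unfolding plane_matrix_def
    using matrix_works[of "\<lambda>h. plane_of_complex (A (complex_of_plane h))" h] has_derivative_linear[OF D]
    by (simp add: linear_def scalar_mult_eq_scaleR[abs_def])
  with D show ?thesis by simp
qed

lemma continuous_on_plane_matrix:
  assumes "\<And>h. continuous_on UNIV (\<lambda>w. D w h)"
  shows "continuous_on UNIV (\<lambda>x. plane_matrix (D (complex_of_plane x)))"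
  unfolding plane_matrix_def matrix_def
  by (intro continuous_on_vec_lambda continuous_on_component
      bounded_linear.continuous_on[OF bounded_linear_plane_of_complex]
      continuous_on_compose2[OF assms] bounded_linear.continuous_on[OF bounded_linear_complex_of_plane]
      continuous_on_id) auto

lemma perforated_disk_open_bounded: "open (perforated_disk n R0 a R)" "bounded (perforated_disk n R0 a R)"
  unfolding perforated_disk_def
  by (auto intro!: open_Diff closed_UN intro: bounded_subset[OF bounded_ball])

theorem theorem6p1:
  fixes n :: nat and R0 lam :: real
    and a :: "nat \<Rightarrow> real^2" and v :: "nat \<Rightarrow> real"
    and z :: "nat \<Rightarrow> real \<Rightarrow> real^2" and L :: "nat \<Rightarrow> real \<Rightarrow> real"
    and R :: "nat \<Rightarrow> real"
  assumes "R0 > 0"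
    and "attainable_via n R0 a v lam z L"
    and "\<forall>i\<in>{1..n}. R i > 0"
    and "\<forall>t\<in>{1..lam}.
           disjoint_family_on (\<lambda>i. cball (z i t) (sqrt ((L i t)\<^sup>2 + (R i)\<^sup>2))) {1..n} \<and>
           (\<forall>i\<in>{1..n}. cball (z i t) (sqrt ((L i t)\<^sup>2 + (R i)\<^sup>2)) \<subseteq> ball 0 (t * R0))"
  shows "\<exists>(u :: real^2 \<Rightarrow> real^2) (Du :: real^2 \<Rightarrow> real^2^2).
           W1p 2 (perforated_disk n R0 a R) u Du \<and>
           circle_trace 2 (perforated_disk n R0 a R) u Du 0 R0 u \<and>
           (\<forall>x\<in>sphere 0 R0. u x = lam *\<^sub>R x) \<and>
           (AE x in lebesgue_on (perforated_disk n R0 a R). det (Du x) = 1) \<and>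
           INV 2 (ball 0 R0) (perforated_disk n R0 a R) u \<and>
           (\<forall>i\<in>{1..n}.
              circle_trace 2 (perforated_disk n R0 a R) u Du (a i) (R i) u \<and>
              (\<forall>\<theta>\<in>{0..2*pi}.
                 u (a i + R i *\<^sub>R expi2 \<theta>) =
                   z i lam + sqrt ((L i lam)\<^sup>2 + (R i)\<^sup>2) *\<^sub>R expi2 \<theta>))"
proof -
  let ?E = "perforated_disk n R0 a R"
  have lam: "lam > 1"
    and area: "\<And>t. t \<in> {1..lam} \<Longrightarrow> (\<Sum>i=1..n. pi * (L i t)\<^sup>2) = (t\<^sup>2 - 1) * pi * R0\<^sup>2"
    and C1z: "\<And>i. i \<in> {1..n} \<Longrightarrow> C1_on_interval 1 lam (z i)"
    and C1L: "\<And>i. i \<in> {1..n} \<Longrightarrow> C1_on_interval 1 lam (\<lambda>t. (L i t)\<^sup>2)"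
    and init: "\<And>i. i \<in> {1..n} \<Longrightarrow> z i 1 = a i" "\<And>i. i \<in> {1..n} \<Longrightarrow> L i 1 = 0"
    using assms(2) unfolding attainable_via_def by blast+
  have R: "\<And>i. i \<in> {1..n} \<Longrightarrow> R i > 0" using assms(3) by blast
  have t1: "1 \<in> {1..lam}" and tl: "lam \<in> {1..lam}" using lam by auto
  obtain dz where dz: "\<And>i t. i \<in> {1..n} \<Longrightarrow> t \<in> {1..lam} \<Longrightarrow> (z i has_vector_derivative dz i t) (at t within {1..lam})"
      "\<And>i. i \<in> {1..n} \<Longrightarrow> continuous_on {1..lam} (dz i)"
    using C1z unfolding C1_on_interval_def by metis
  obtain dl where dl: "\<And>i t. i \<in> {1..n} \<Longrightarrow> t \<in> {1..lam} \<Longrightarrow>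
        ((\<lambda>t. (L i t)\<^sup>2) has_vector_derivative dl i t) (at t within {1..lam})"
      "\<And>i. i \<in> {1..n} \<Longrightarrow> continuous_on {1..lam} (dl i)"
    using C1L unfolding C1_on_interval_def by metis
  define r where "r i t = sqrt ((L i t)\<^sup>2 + (R i)\<^sup>2)" for i t
  have r_pos: "r i t > 0" if "i \<in> {1..n}" for i t
    using R[OF that] by (simp add: r_def add_nonneg_pos)
  have R_le_r: "R i \<le> r i t" if "i \<in> {1..n}" for i t
    using R[OF that] by (auto simp: r_def intro: real_le_rsqrt)
  have r_deriv: "(r i has_real_derivative (dl i t / 2) / r i t) (at t within {1..lam})"
    if "i \<in> {1..n}" "t \<in> {1..lam}" for i t
  proof -
    have "(L i t)\<^sup>2 + (R i)\<^sup>2 > 0" using R[OF that(1)] by (simp add: add_nonneg_pos)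
    from DERIV_chain2[OF DERIV_real_sqrt[OF this]
        DERIV_add[OF dl(1)[OF that, folded has_real_derivative_iff_has_vector_derivative] DERIV_const]]
    show ?thesis unfolding r_def by (rule DERIV_cong) (simp add: field_simps)
  qed
  have flux: "(\<Sum>i\<in>{1..n}. dl i t / 2) = t * R0\<^sup>2" if t: "t \<in> {1..lam}" for t
  proof -
    \<comment> \<open>Balance of the fluxes is the time derivative of the incompressibility constraint.\<close>
    have eq: "(\<Sum>i=1..n. (L i s)\<^sup>2) = (s\<^sup>2 - 1) * R0\<^sup>2" if "s \<in> {1..lam}" for s
      using area[OF that] by (simp add: sum_distrib_left[symmetric])
    have "((\<lambda>s. \<Sum>i=1..n. (L i s)\<^sup>2) has_vector_derivative (\<Sum>i=1..n. dl i t)) (at t within {1..lam})"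
      using dl(1) t by (intro has_vector_derivative_sum) auto
    moreover have "((\<lambda>s. (s\<^sup>2 - 1) * R0\<^sup>2) has_vector_derivative 2 * t * R0\<^sup>2) (at t within {1..lam})"
      unfolding has_real_derivative_iff_has_vector_derivative[symmetric]
      by (auto intro!: derivative_eq_intros)
    then have "((\<lambda>s. \<Sum>i=1..n. (L i s)\<^sup>2) has_vector_derivative 2 * t * R0\<^sup>2) (at t within {1..lam})"
      by (rule has_vector_derivative_transform[OF t, rotated]) (rule eq)
    ultimately have "(\<Sum>i=1..n. dl i t) = 2 * t * R0\<^sup>2"
      using vector_derivative_unique_within_closed_interval[of 1 lam t] lam t by (metis cbox_interval)
    then show ?thesis by (simp add: sum_divide_distrib[symmetric])
  qed
  have cont_z: "continuous_on {1..lam} (z i)" if "i \<in> {1..n}" for i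
    using dz(1)[OF that] by (meson continuous_on_eq_continuous_within has_vector_derivative_continuous)
  have cont_r: "continuous_on {1..lam} (r i)" if "i \<in> {1..n}" for i
    using r_deriv[OF that] by (meson continuous_on_eq_continuous_within DERIV_continuous)
  have apart: "norm (z i t - z j t) - r i t - r j t > 0"
    if "i \<in> {1..n}" "j \<in> {1..n}" "i \<noteq> j" "t \<in> {1..lam}" for i j t
  proof -
    have "cball (z i t) (r i t) \<inter> cball (z j t) (r j t) = {}"
      using assms(4) that unfolding disjoint_family_on_def r_def by blast
    from disjoint_cballs_imp_dist[OF this r_pos r_pos] that show ?thesis by (simp add: dist_norm)
  qed
  have inside: "t * R0 - norm (z i t) - r i t > 0" if "i \<in> {1..n}" "t \<in> {1..lam}" for i t
  proof -
    have "cball (z i t) (r i t) \<subseteq> ball 0 (t * R0)" using assms(4) that unfolding r_def by blast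
    then show ?thesis using r_pos[OF that(1), of t] by (simp add: cball_subset_ball_iff)
  qed
  \<comment> \<open>Compactness of the time interval makes the gaps between the circles uniform.\<close>
  obtain \<delta>1 where \<delta>1: "\<delta>1 > 0" "\<And>i j t. i \<in> {1..n} \<Longrightarrow> j \<in> {1..n} \<Longrightarrow> i \<noteq> j \<Longrightarrow> t \<in> {1..lam} \<Longrightarrow>
      \<delta>1 \<le> norm (z i t - z j t) - r i t - r j t"
    using finite_family_uniform_lower_bound[of "{p \<in> {1..n} \<times> {1..n}. fst p \<noteq> snd p}" 1 lam
        "\<lambda>p t. norm (z (fst p) t - z (snd p) t) - r (fst p) t - r (snd p) t"] apart
    by (force intro!: continuous_intros cont_z cont_r)
  obtain \<delta>2 where \<delta>2: "\<delta>2 > 0" "\<And>i t. i \<in> {1..n} \<Longrightarrow> t \<in> {1..lam} \<Longrightarrow> \<delta>2 \<le> t * R0 - norm (z i t) - r i t"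
    using finite_family_uniform_lower_bound[of "{1..n}" 1 lam "\<lambda>i t. t * R0 - norm (z i t) - r i t"] inside
    by (force intro!: continuous_intros cont_z cont_r)
  define \<delta> where "\<delta> = min \<delta>1 \<delta>2 / 2"
  let ?z = "\<lambda>i t. complex_of_plane (z i t)"
  interpret moving_disks "{1..n}" lam R0 \<delta> ?z "\<lambda>i t. complex_of_plane (dz i t)" r "\<lambda>i t. dl i t / 2" R
  proof
    show "r i t + r j t + 2 * \<delta> \<le> cmod (?z i t - ?z j t)"
      if "i \<in> {1..n}" "j \<in> {1..n}" "i \<noteq> j" "t \<in> {1..lam}" for i j t
      using \<delta>1(2)[OF that] by (simp add: \<delta>_def flip: complex_of_plane_linear)
    show "cmod (?z i t) + r i t + 2 * \<delta> \<le> t * R0" if "i \<in> {1..n}" "t \<in> {1..lam}" for i t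
      using \<delta>2(2)[OF that] by (simp add: \<delta>_def)
    show "(?z i has_vector_derivative complex_of_plane (dz i t)) (at t within {1..lam})"
      if "i \<in> {1..n}" "t \<in> {1..lam}" for i t
      by (rule bounded_linear.has_vector_derivative[OF bounded_linear_complex_of_plane dz(1)[OF that]])
    show "continuous_on {1..lam} (\<lambda>t. complex_of_plane (dz i t))" if "i \<in> {1..n}" for i
      by (rule bounded_linear.continuous_on[OF bounded_linear_complex_of_plane dz(2)[OF that]])
    show "continuous_on {1..lam} (\<lambda>t. dl i t / 2)" if "i \<in> {1..n}" for i
      by (intro continuous_intros dl(2)[OF that]) simp
  qed (use lam assms(1) \<delta>1(1) \<delta>2(1) R R_le_r r_deriv flux in \<open>auto simp: \<delta>_def\<close>)
  obtain \<Phi> D where \<Phi>: "continuous_on ({1..lam} \<times> UNIV) (\<lambda>p. \<Phi> (fst p) (snd p))"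
      "\<And>t. t \<in> {1..lam} \<Longrightarrow> inj (\<Phi> t)" "\<And>w. \<Phi> 1 w = w"
    and D: "\<And>w. (\<Phi> lam has_derivative D w) (at w)" "\<And>h. continuous_on UNIV (\<lambda>w. D w h)"
    and det: "\<And>w. norm w < R0 \<Longrightarrow> (\<And>i. i \<in> {1..n} \<Longrightarrow> norm (w - ?z i 1) > r i 1) \<Longrightarrow> cross2 (D w 1) (D w \<i>) = 1"
    and hole: "\<And>i \<zeta>. i \<in> {1..n} \<Longrightarrow> norm \<zeta> = 1 \<Longrightarrow> \<Phi> lam (?z i 1 + r i 1 *\<^sub>R \<zeta>) = ?z i lam + r i lam *\<^sub>R \<zeta>"
    and rim: "\<And>\<zeta>. norm \<zeta> = 1 \<Longrightarrow> \<Phi> lam (R0 *\<^sub>R \<zeta>) = (lam * R0) *\<^sub>R \<zeta>"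
    using exists_isotopy by blast
  have r1: "r i 1 = R i" if "i \<in> {1..n}" for i
    using init(2)[OF that] R[OF that] by (simp add: r_def)
  define u where "u x = plane_of_complex (\<Phi> lam (complex_of_plane x))" for x
  define Du where "Du x = plane_matrix (D (complex_of_plane x))" for x
  have u: "complex_of_plane (u x) = \<Phi> lam (complex_of_plane x)" for x by (simp add: u_def)
  have der: "(u has_derivative (\<lambda>h. Du x *v h)) (at x)" for x
    unfolding u_def[abs_def] Du_def by (rule plane_conjugate_has_derivative[OF D(1)])
  have contD: "continuous_on UNIV Du"
    unfolding Du_def[abs_def] by (rule continuous_on_plane_matrix[OF D(2)])
  have contu: "continuous_on UNIV u"
    using der by (meson continuous_at_imp_continuous_on has_derivative_continuous)
  have W: "W1p 2 ?E u Du"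
    by (rule W1p_of_C1[OF perforated_disk_open_bounded _ der contD]) simp
  have trace: "circle_trace 2 ?E u Du c \<rho> u" for c \<rho>
    by (rule circle_trace_continuous[OF W contu]) simp
  have "u x = lam *\<^sub>R x" if "x \<in> sphere 0 R0" for x
  proof -
    define \<zeta> where "\<zeta> = complex_of_plane x /\<^sub>R R0"
    have "norm \<zeta> = 1" "complex_of_plane x = R0 *\<^sub>R \<zeta>"
      using that assms(1) by (auto simp: \<zeta>_def)
    then have "complex_of_plane (u x) = complex_of_plane (lam *\<^sub>R x)"
      using rim[of \<zeta>] by (simp add: u complex_of_plane_linear)
    then show ?thesis by (simp only: complex_of_plane_eq_iff)
  qed
  moreover have "det (Du x) = 1" if "x \<in> ?E" for x
    unfolding Du_def det_plane_matrix
  proof (rule det)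
    show "cmod (complex_of_plane x) < R0" using that by (simp add: perforated_disk_def)
    show "r i 1 < cmod (complex_of_plane x - ?z i 1)" if i: "i \<in> {1..n}" for i
    proof -
      have "x \<notin> cball (a i) (R i)" using \<open>x \<in> ?E\<close> i by (auto simp: perforated_disk_def)
      then show ?thesis
        using init(1)[OF i] r1[OF i]
        by (simp add: dist_norm norm_minus_commute flip: complex_of_plane_linear)
    qed
  qed
  then have "AE x in lebesgue_on ?E. det (Du x) = 1"
    by (intro AE_I2) simp
  moreover have "INV 2 (ball 0 R0) ?E u"
    by (rule INV_of_isotopy[OF _ _ \<Phi> u der contD]) (use lam in auto)
  moreover have "u (a i + R i *\<^sub>R expi2 \<theta>) = z i lam + sqrt ((L i lam)\<^sup>2 + (R i)\<^sup>2) *\<^sub>R expi2 \<theta>"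
    if i: "i \<in> {1..n}" for i \<theta>
  proof -
    have "complex_of_plane (u (a i + R i *\<^sub>R expi2 \<theta>)) = complex_of_plane (z i lam + r i lam *\<^sub>R expi2 \<theta>)"
      using hole[OF i, of "cis \<theta>"] init(1)[OF i] r1[OF i]
      by (simp add: u complex_of_plane_linear complex_of_plane_expi2)
    then show ?thesis by (simp only: complex_of_plane_eq_iff r_def)
  qed
  ultimately show ?thesis using W trace by blast
qed

end
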